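(* Let $\Theta$ be a variety of many-sorted algebras such that $\Phi(F(x^{(i)}))\cong F(x^{(i)})$ for every automorphism $\Phi$ of the category $\Theta^0$, every sort $i\in\Gamma$ and every $x^{(i)}\in X_0^{(i)}$. Algebras $H_1,H_2\in\Theta$ are automorphically equivalent if and only if there is a system of words $W=\{w_\omega\mid\omega\in\Omega\}$ fulfilling the conditions Op1) and Op2) such that the algebras $H_1$ and $(H_2)_W^*$ are geometrically equivalent.
   Context: Many-sorted algebras. Fix a finite set $\Gamma$ of names of sorts and a signature $\Omega$; each $\omega\in\Omega$ has a type $\tau_\omega=(i_1,\ldots,i_n;j)$ with $n\in\mathbb{N}$ ($n=0$ allowed: a constant of sort $j$) and $i_1,\ldots,i_n,j\in\Gamma$. An algebra is a set $A$ with a map $\eta_A:A\to\Gamma$ and, for each $\omega\in\Omega$ of type $(i_1,\ldots,i_n;j)$, an operation $A^{(i_1)}\times\cdots\times A^{(i_n)}\to A^{(j)}$, where $A^{(i)}=\eta_A^{-1}(i)$. The sets $A^{(i)}$ may be empty; $\Gamma_A=\mathrm{im}\,\eta_A$. A homomorphism $\varphi:A\to B$ is a map with $\eta_A=\eta_B\varphi$ commuting with all operations (so $\mathrm{Hom}(A,B)=\varnothing$ if $\Gamma_A\nsubseteq\Gamma_B$). Congruences are compatible equivalences contained in $\bigcup_{i\in\Gamma}(A^{(i)})^2$. An identity $w_1=w_2$ is a pair of terms of the same sort over a $\Gamma$-sorted alphabet; if $X'$ is the finite set of letters occurring in $w_1$ or $w_2$, the identity holds in $A$ if $\varphi(w_1)=\varphi(w_2)$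 for every homomorphism $\varphi$ from the term algebra over $X'$ to $A$. A variety $\Theta$ is the class of all algebras satisfying a given set of identities. An algebra $F=F(X)\in\Theta$ is free with set of free generators $X\subset F$ if for every $A\in\Theta$ with $\Gamma_A\supseteq\eta_F(X)$ every sort-preserving map $X\to A$ extends to a unique homomorphism $F\to A$. The category $\Theta^0$. Let $X_0$ be a $\Gamma$-sorted set such that the set $X_0^{(i)}$ of its elements of sort $i$ is countably infinite for every $i\in\Gamma$. The objects of $\Theta^0$ are the free algebras $F(X)$ of $\Theta$ with $X\subset X_0$ finite; the morphisms are all homomorphisms between them. $F(x^{(i)})$ is the free algebra on the single generator $x^{(i)}$. Words and verbal operations. For $\omega\in\Omega$ of type $(i_1,\ldots,i_n;j)$ fix $A_\omega=F(X_\omega)\in\mathrm{Ob}\,\Theta^0$ with $X_\omega=\{x^{(i_1)},\ldots,x^{(i_n)}\}$ consisting of $n$ distinct generators, $x^{(i_k)}$ being of sort $i_k$. For a word $w\in F(x_1,\ldots,x_n)=F\in\mathrm{Ob}\,\Theta^0$ and $H\in\Theta$, the verbal operation $w_H^*$ is defined for $h_1,\ldots,h_n\in H$ with $\eta_H(h_k)=\eta_F(x_k)$ by $w_H^*(h_1,\ldots,h_n)=\alpha(w)$, where $\alpha:F\to H$ is the homomorphism with $\alpha(x_k)=h_k$. For a system of words $W=\{w_\omega\in A_\omega\mid\omega\in\Omega\}$, $H_W^*$ denotes the algebra with the same underlying sorted set as $H$ in which each $\omega\in\Omega$ is interpreted by the verbal operation defined by $w_\omega$. Conditions on a system of words $W$: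 Op1) $W=\{w_\omega\in A_\omega\mid\omega\in\Omega\}$; Op2) for every $F=F(X)\in\mathrm{Ob}\,\Theta^0$ there is a bijection $s_F:F\to F$ such that $s_F|_X=\mathrm{id}_X$ and $s_F:F\to F_W^*$ is an isomorphism (in particular each $w_\omega$ has the sort $j$ of the result of $\omega$). Algebraic geometry. Let $H$ be a $\Gamma$-sorted algebra with signature $\Omega$. For $F\in\mathrm{Ob}\,\Theta^0$ and $T\subseteq\bigcup_{i\in\Gamma}(F^{(i)})^2$ put $T_H''=\bigcap\{\ker\varphi\mid\varphi\in\mathrm{Hom}(F,H),\ T\subseteq\ker\varphi\}$, where $\ker\varphi=\{(a,b)\mid\varphi(a)=\varphi(b)\}$ and the intersection of the empty family is $\bigcup_{i\in\Gamma}(F^{(i)})^2$. $T$ is algebraically closed over $H$ if $T_H''=T$; $Cl_H(F)$ is the family of all $T\subseteq\bigcup_{i\in\Gamma}(F^{(i)})^2$ algebraically closed over $H$. Algebras $H_1,H_2$ are geometrically equivalent if $T_{H_1}''=T_{H_2}''$ for every $F\in\mathrm{Ob}\,\Theta^0$ and every such $T$. Automorphic equivalence. Algebras $H_1,H_2\in\Theta$ are automorphically equivalent if there exist an automorphism $\Phi:\Theta^0\to\Theta^0$ and bijections $\alpha(\Phi)_A:Cl_{H_1}(A)\to Cl_{H_2}(\Phi(A))$ for every $A\in\mathrm{Ob}\,\Theta^0$ such that for all $A_1,A_2\in\mathrm{Ob}\,\Theta^0$, $\mu_1,\mu_2\in\mathrm{Hom}(A_1,A_2)$ and $T\in Cl_{H_1}(A_2)$: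 $\tau\mu_1=\tau\mu_2$ if and only if $\widetilde\tau\Phi(\mu_1)=\widetilde\tau\Phi(\mu_2)$, where $\tau:A_2\to A_2/T$ and $\widetilde\tau:\Phi(A_2)\to\Phi(A_2)/\alpha(\Phi)_{A_2}(T)$ are the natural epimorphisms. *)

theory Defs
  imports "HOL-Library.FuncSet" "HOL-Library.Countable_Set"
begin

record ('s, 'o) signature =
  sorts :: "'s set"
  ops :: "'o set"
  arity :: "'o \<Rightarrow> 's list"
  result :: "'o \<Rightarrow> 's"

definition wf_signature :: "('s, 'o) signature \<Rightarrow> bool" where
  "wf_signature \<Sigma> \<longleftrightarrow> finite (sorts \<Sigma>) \<and>
     (\<forall>\<omega>\<in>ops \<Sigma>. set (arity \<Sigma> \<omega>) \<subseteq> sorts \<Sigma> \<and> result \<Sigma> \<omega> \<in> sorts \<Sigma>)"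

record ('s, 'o, 'a) alg =
  elems :: "'a set"
  srt :: "'a \<Rightarrow> 's"
  interp :: "'o \<Rightarrow> 'a list \<Rightarrow> 'a"

definition component :: "('s, 'o, 'a) alg \<Rightarrow> 's \<Rightarrow> 'a set" where
  "component A i = {a \<in> elems A. srt A a = i}"

definition args :: "('s, 'o, 'a) alg \<Rightarrow> 's list \<Rightarrow> 'a list set" where
  "args A is = {as. list_all2 (\<lambda>a i. a \<in> component A i) as is}"

definition algebra :: "('s, 'o) signature \<Rightarrow> ('s, 'o, 'a) alg \<Rightarrow> bool" where
  "algebra \<Sigma> A \<longleftrightarrow> srt A ` elems A \<subseteq> sorts \<Sigma> \<and>
     (\<forall>\<omega>\<in>ops \<Sigma>. \<forall>as\<in>args A (arity \<Sigma> \<omega>). interp A \<omega> as \<in> component A (result \<Sigma> \<omega>))"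

text \<open>Homomorphisms are extensional functions, so that equality of homomorphisms is equality in HOL.\<close>

definition hom :: "('s, 'o) signature \<Rightarrow> ('s, 'o, 'a) alg \<Rightarrow> ('s, 'o, 'b) alg \<Rightarrow> ('a \<Rightarrow> 'b) set" where
  "hom \<Sigma> A B = {\<phi> \<in> elems A \<rightarrow>\<^sub>E elems B.
     (\<forall>a\<in>elems A. srt B (\<phi> a) = srt A a) \<and>
     (\<forall>\<omega>\<in>ops \<Sigma>. \<forall>as\<in>args A (arity \<Sigma> \<omega>). \<phi> (interp A \<omega> as) = interp B \<omega> (map \<phi> as))}"

definition iso :: "('s, 'o) signature \<Rightarrow> ('s, 'o, 'a) alg \<Rightarrow> ('s, 'o, 'b) alg \<Rightarrow> ('a \<Rightarrow> 'b) set" where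
  "iso \<Sigma> A B = {\<phi> \<in> hom \<Sigma> A B. bij_betw \<phi> (elems A) (elems B)}"

definition isomorphic :: "('s, 'o) signature \<Rightarrow> ('s, 'o, 'a) alg \<Rightarrow> ('s, 'o, 'b) alg \<Rightarrow> bool" where
  "isomorphic \<Sigma> A B \<longleftrightarrow> iso \<Sigma> A B \<noteq> {}"

text \<open>A letter \<open>(i, v)\<close> carries its sort \<open>i\<close>; the type of names \<open>v\<close> is arbitrary.\<close>

datatype ('o, letters: 'x) trm = Letter 'x | App 'o "('o, 'x) trm list"

fun trm_sort :: "('s, 'o) signature \<Rightarrow> ('o, 's \<times> 'v) trm \<Rightarrow> 's" where
  "trm_sort \<Sigma> (Letter x) = fst x"
| "trm_sort \<Sigma> (App \<omega> ts) = result \<Sigma> \<omega>"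

inductive_set trms :: "('s, 'o) signature \<Rightarrow> ('s \<times> 'v) set \<Rightarrow> ('o, 's \<times> 'v) trm set"
  for \<Sigma> :: "('s, 'o) signature" and X :: "('s \<times> 'v) set" where
  Letter: "x \<in> X \<Longrightarrow> fst x \<in> sorts \<Sigma> \<Longrightarrow> Letter x \<in> trms \<Sigma> X"
| App: "\<omega> \<in> ops \<Sigma> \<Longrightarrow> list_all2 (\<lambda>t i. t \<in> trms \<Sigma> X \<and> trm_sort \<Sigma> t = i) ts (arity \<Sigma> \<omega>) \<Longrightarrow>
    App \<omega> ts \<in> trms \<Sigma> X"

definition trm_alg :: "('s, 'o) signature \<Rightarrow> ('s \<times> 'v) set \<Rightarrow> ('s, 'o, ('o, 's \<times> 'v) trm) alg" where
  "trm_alg \<Sigma> X = \<lparr>elems = trms \<Sigma> X, srt = trm_sort \<Sigma>, interp = App\<rparr>"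

definition is_identity :: "('s, 'o) signature \<Rightarrow> ('o, 's \<times> 'v) trm \<times> ('o, 's \<times> 'v) trm \<Rightarrow> bool" where
  "is_identity \<Sigma> = (\<lambda>(w\<^sub>1, w\<^sub>2). w\<^sub>1 \<in> trms \<Sigma> UNIV \<and> w\<^sub>2 \<in> trms \<Sigma> UNIV \<and> trm_sort \<Sigma> w\<^sub>1 = trm_sort \<Sigma> w\<^sub>2)"

definition satisfies ::
    "('s, 'o) signature \<Rightarrow> ('s, 'o, 'a) alg \<Rightarrow> ('o, 's \<times> 'v) trm \<times> ('o, 's \<times> 'v) trm \<Rightarrow> bool" where
  "satisfies \<Sigma> A = (\<lambda>(w\<^sub>1, w\<^sub>2).
     \<forall>\<phi>\<in>hom \<Sigma> (trm_alg \<Sigma> (letters w\<^sub>1 \<union> letters w\<^sub>2)) A. \<phi> w\<^sub>1 = \<phi> w\<^sub>2)"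

text \<open>The element type \<open>'a\<close> plays the role of the universe of sets: the class of all algebras
  becomes the set of all algebras whose elements are taken from \<open>'a\<close>.\<close>

definition variety ::
    "('s, 'o) signature \<Rightarrow> (('o, 's \<times> 'v) trm \<times> ('o, 's \<times> 'v) trm) set \<Rightarrow> ('s, 'o, 'a) alg set" where
  "variety \<Sigma> E = {A. algebra \<Sigma> A \<and> (\<forall>e\<in>E. satisfies \<Sigma> A e)}"

definition free_on ::
    "('s, 'o) signature \<Rightarrow> ('s, 'o, 'a) alg set \<Rightarrow> ('s, 'o, 'a) alg \<Rightarrow> 'a set \<Rightarrow> bool" where
  "free_on \<Sigma> \<Theta> F X \<longleftrightarrow> F \<in> \<Theta> \<and> X \<subseteq> elems F \<and>
     (\<forall>A\<in>\<Theta>. srt F ` X \<subseteq> srt A ` elems A \<longrightarrow>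
        (\<forall>f. (\<forall>x\<in>X. f x \<in> component A (srt F x)) \<longrightarrow>
           (\<exists>!\<phi>. \<phi> \<in> hom \<Sigma> F A \<and> (\<forall>x\<in>X. \<phi> x = f x))))"

definition sorted_alphabet :: "('s, 'o) signature \<Rightarrow> 'a set \<Rightarrow> ('a \<Rightarrow> 's) \<Rightarrow> bool" where
  "sorted_alphabet \<Sigma> X\<^sub>0 \<eta>\<^sub>0 \<longleftrightarrow> \<eta>\<^sub>0 ` X\<^sub>0 \<subseteq> sorts \<Sigma> \<and>
     (\<forall>i\<in>sorts \<Sigma>. countable {x \<in> X\<^sub>0. \<eta>\<^sub>0 x = i} \<and> infinite {x \<in> X\<^sub>0. \<eta>\<^sub>0 x = i})"

definition free_over ::
    "('s, 'o) signature \<Rightarrow> ('s, 'o, 'a) alg set \<Rightarrow> ('a \<Rightarrow> 's) \<Rightarrow> 'a set \<Rightarrow> ('s, 'o, 'a) alg \<Rightarrow> bool" where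
  "free_over \<Sigma> \<Theta> \<eta>\<^sub>0 X A \<longleftrightarrow> free_on \<Sigma> \<Theta> A X \<and> (\<forall>x\<in>X. srt A x = \<eta>\<^sub>0 x)"

text \<open>The function \<open>F\<close> picks the free algebra \<open>F(X)\<close> for every finite \<open>X \<subseteq> X\<^sub>0\<close> that has one.  The
  existence condition matters for degenerate varieties: if an identity forces two distinct letters to be
  equal, then no free algebra contains both of them among its free generators.  Free algebras on a single generator
  always exist, provided that the universe \<open>'a\<close> is large enough.\<close>

definition free_choice ::
    "('s, 'o) signature \<Rightarrow> ('s, 'o, 'a) alg set \<Rightarrow> 'a set \<Rightarrow> ('a \<Rightarrow> 's) \<Rightarrow> ('a set \<Rightarrow> ('s, 'o, 'a) alg) \<Rightarrow> bool" where
  "free_choice \<Sigma> \<Theta> X\<^sub>0 \<eta>\<^sub>0 F \<longleftrightarrow>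
     (\<forall>X. finite X \<and> X \<subseteq> X\<^sub>0 \<and> (\<exists>A. free_over \<Sigma> \<Theta> \<eta>\<^sub>0 X A) \<longrightarrow> free_over \<Sigma> \<Theta> \<eta>\<^sub>0 X (F X))"

text \<open>An object \<open>F(X)\<close> is represented by its set \<open>X\<close> of free generators; the morphisms
  from \<open>X\<close> to \<open>Y\<close> are the elements of \<open>hom \<Sigma> (F X) (F Y)\<close>.\<close>

definition Ob ::
    "('s, 'o) signature \<Rightarrow> ('s, 'o, 'a) alg set \<Rightarrow> 'a set \<Rightarrow> ('a \<Rightarrow> 's) \<Rightarrow> ('a set \<Rightarrow> ('s, 'o, 'a) alg) \<Rightarrow>
      'a set set" where
  "Ob \<Sigma> \<Theta> X\<^sub>0 \<eta>\<^sub>0 F = {X. finite X \<and> X \<subseteq> X\<^sub>0 \<and> free_over \<Sigma> \<Theta> \<eta>\<^sub>0 X (F X)}"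

text \<open>In what follows \<open>C\<close> is the set of objects.  A functor consists of its object part \<open>\<Phi>\<close> and its
  morphism parts \<open>\<Psi> X Y\<close>.\<close>

definition endofunctor ::
    "('s, 'o) signature \<Rightarrow> ('a set \<Rightarrow> ('s, 'o, 'a) alg) \<Rightarrow> 'a set set \<Rightarrow> ('a set \<Rightarrow> 'a set) \<Rightarrow>
      ('a set \<Rightarrow> 'a set \<Rightarrow> ('a \<Rightarrow> 'a) \<Rightarrow> ('a \<Rightarrow> 'a)) \<Rightarrow> bool" where
  "endofunctor \<Sigma> F C \<Phi> \<Psi> \<longleftrightarrow>
     \<Phi> \<in> C \<rightarrow> C \<and>
     (\<forall>X\<in>C. \<forall>Y\<in>C. \<Psi> X Y \<in> hom \<Sigma> (F X) (F Y) \<rightarrow> hom \<Sigma> (F (\<Phi> X)) (F (\<Phi> Y))) \<and>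
     (\<forall>X\<in>C. \<Psi> X X (\<lambda>a\<in>elems (F X). a) = (\<lambda>a\<in>elems (F (\<Phi> X)). a)) \<and>
     (\<forall>X\<in>C. \<forall>Y\<in>C. \<forall>Z\<in>C. \<forall>\<mu>\<in>hom \<Sigma> (F X) (F Y). \<forall>\<nu>\<in>hom \<Sigma> (F Y) (F Z).
        \<Psi> X Z (compose (elems (F X)) \<nu> \<mu>) = compose (elems (F (\<Phi> X))) (\<Psi> Y Z \<nu>) (\<Psi> X Y \<mu>))"

definition cat_automorphism ::
    "('s, 'o) signature \<Rightarrow> ('a set \<Rightarrow> ('s, 'o, 'a) alg) \<Rightarrow> 'a set set \<Rightarrow> ('a set \<Rightarrow> 'a set) \<Rightarrow>
      ('a set \<Rightarrow> 'a set \<Rightarrow> ('a \<Rightarrow> 'a) \<Rightarrow> ('a \<Rightarrow> 'a)) \<Rightarrow> bool" where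
  "cat_automorphism \<Sigma> F C \<Phi> \<Psi> \<longleftrightarrow> endofunctor \<Sigma> F C \<Phi> \<Psi> \<and> bij_betw \<Phi> C C \<and>
     (\<forall>X\<in>C. \<forall>Y\<in>C. bij_betw (\<Psi> X Y) (hom \<Sigma> (F X) (F Y)) (hom \<Sigma> (F (\<Phi> X)) (F (\<Phi> Y))))"

text \<open>The generating set of \<open>A\<^sub>\<omega>\<close> is given by the list \<open>xs \<omega>\<close>, in the order of the arguments of \<open>\<omega>\<close>.\<close>

definition op_generators ::
    "('s, 'o) signature \<Rightarrow> ('a \<Rightarrow> 's) \<Rightarrow> 'a set set \<Rightarrow> ('o \<Rightarrow> 'a list) \<Rightarrow> bool" where
  "op_generators \<Sigma> \<eta>\<^sub>0 C xs \<longleftrightarrow>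
     (\<forall>\<omega>\<in>ops \<Sigma>. distinct (xs \<omega>) \<and> map \<eta>\<^sub>0 (xs \<omega>) = arity \<Sigma> \<omega> \<and> set (xs \<omega>) \<in> C)"

definition verbal ::
    "('s, 'o) signature \<Rightarrow> ('s, 'o, 'a) alg \<Rightarrow> 'a list \<Rightarrow> 'a \<Rightarrow> ('s, 'o, 'a) alg \<Rightarrow> 'a list \<Rightarrow> 'a" where
  "verbal \<Sigma> A xs w H hs = (THE \<alpha>. \<alpha> \<in> hom \<Sigma> A H \<and> map \<alpha> xs = hs) w"

definition verbal_alg ::
    "('s, 'o) signature \<Rightarrow> ('a set \<Rightarrow> ('s, 'o, 'a) alg) \<Rightarrow> ('o \<Rightarrow> 'a list) \<Rightarrow> ('o \<Rightarrow> 'a) \<Rightarrow>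
      ('s, 'o, 'a) alg \<Rightarrow> ('s, 'o, 'a) alg" where
  "verbal_alg \<Sigma> F xs W H =
     \<lparr>elems = elems H, srt = srt H, interp = (\<lambda>\<omega>. verbal \<Sigma> (F (set (xs \<omega>))) (xs \<omega>) (W \<omega>) H)\<rparr>"

definition Op1 ::
    "('s, 'o) signature \<Rightarrow> ('a set \<Rightarrow> ('s, 'o, 'a) alg) \<Rightarrow> ('o \<Rightarrow> 'a list) \<Rightarrow> ('o \<Rightarrow> 'a) \<Rightarrow> bool" where
  "Op1 \<Sigma> F xs W \<longleftrightarrow> (\<forall>\<omega>\<in>ops \<Sigma>. W \<omega> \<in> elems (F (set (xs \<omega>))))"

definition Op2 ::
    "('s, 'o) signature \<Rightarrow> ('a set \<Rightarrow> ('s, 'o, 'a) alg) \<Rightarrow> 'a set set \<Rightarrow> ('o \<Rightarrow> 'a list) \<Rightarrow> ('o \<Rightarrow> 'a) \<Rightarrow> bool" where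
  "Op2 \<Sigma> F C xs W \<longleftrightarrow>
     (\<forall>X\<in>C. \<exists>s\<in>iso \<Sigma> (F X) (verbal_alg \<Sigma> F xs W (F X)). \<forall>x\<in>X. s x = x)"

definition sorted_pairs :: "('s, 'o, 'a) alg \<Rightarrow> ('a \<times> 'a) set" where
  "sorted_pairs A = (\<Union>i. component A i \<times> component A i)"

definition ker :: "('s, 'o, 'a) alg \<Rightarrow> ('a \<Rightarrow> 'b) \<Rightarrow> ('a \<times> 'a) set" where
  "ker A \<phi> = {(a, b). a \<in> elems A \<and> b \<in> elems A \<and> \<phi> a = \<phi> b}"

text \<open>Kernels of homomorphisms are contained in \<open>sorted_pairs\<close>, so intersecting with this set only
  serves to fix the value for the empty family.\<close>

definition alg_closure ::
    "('s, 'o) signature \<Rightarrow> ('s, 'o, 'b) alg \<Rightarrow> ('s, 'o, 'a) alg \<Rightarrow> ('a \<times> 'a) set \<Rightarrow> ('a \<times> 'a) set" where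
  "alg_closure \<Sigma> H A T = sorted_pairs A \<inter> \<Inter> {ker A \<phi> | \<phi>. \<phi> \<in> hom \<Sigma> A H \<and> T \<subseteq> ker A \<phi>}"

definition Cl :: "('s, 'o) signature \<Rightarrow> ('s, 'o, 'b) alg \<Rightarrow> ('s, 'o, 'a) alg \<Rightarrow> ('a \<times> 'a) set set" where
  "Cl \<Sigma> H A = {T. T \<subseteq> sorted_pairs A \<and> alg_closure \<Sigma> H A T = T}"

definition geom_equiv ::
    "('s, 'o) signature \<Rightarrow> ('a set \<Rightarrow> ('s, 'o, 'a) alg) \<Rightarrow> 'a set set \<Rightarrow>
      ('s, 'o, 'a) alg \<Rightarrow> ('s, 'o, 'a) alg \<Rightarrow> bool" where
  "geom_equiv \<Sigma> F C H\<^sub>1 H\<^sub>2 \<longleftrightarrow>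
     (\<forall>X\<in>C. \<forall>T. T \<subseteq> sorted_pairs (F X) \<longrightarrow> alg_closure \<Sigma> H\<^sub>1 (F X) T = alg_closure \<Sigma> H\<^sub>2 (F X) T)"

definition nat_epi :: "('s, 'o, 'a) alg \<Rightarrow> ('a \<times> 'a) set \<Rightarrow> 'a \<Rightarrow> 'a set" where
  "nat_epi A T = (\<lambda>a\<in>elems A. T `` {a})"

definition auto_equiv ::
    "('s, 'o) signature \<Rightarrow> ('a set \<Rightarrow> ('s, 'o, 'a) alg) \<Rightarrow> 'a set set \<Rightarrow>
      ('s, 'o, 'a) alg \<Rightarrow> ('s, 'o, 'a) alg \<Rightarrow> bool" where
  "auto_equiv \<Sigma> F C H\<^sub>1 H\<^sub>2 \<longleftrightarrow>
     (\<exists>\<Phi> \<Psi> \<alpha>. cat_automorphism \<Sigma> F C \<Phi> \<Psi> \<and>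
        (\<forall>X\<in>C. bij_betw (\<alpha> X) (Cl \<Sigma> H\<^sub>1 (F X)) (Cl \<Sigma> H\<^sub>2 (F (\<Phi> X)))) \<and>
        (\<forall>X\<in>C. \<forall>Y\<in>C. \<forall>\<mu>\<^sub>1\<in>hom \<Sigma> (F X) (F Y). \<forall>\<mu>\<^sub>2\<in>hom \<Sigma> (F X) (F Y). \<forall>T\<in>Cl \<Sigma> H\<^sub>1 (F Y).
           compose (elems (F X)) (nat_epi (F Y) T) \<mu>\<^sub>1 = compose (elems (F X)) (nat_epi (F Y) T) \<mu>\<^sub>2 \<longleftrightarrow>
           compose (elems (F (\<Phi> X))) (nat_epi (F (\<Phi> Y)) (\<alpha> Y T)) (\<Psi> X Y \<mu>\<^sub>1) =
           compose (elems (F (\<Phi> X))) (nat_epi (F (\<Phi> Y)) (\<alpha> Y T)) (\<Psi> X Y \<mu>\<^sub>2)))"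

end

theory Submission
  imports Defs
begin

text \<open>An automorphism \<open>\<Phi>\<close> with \<open>\<Phi>(F(x\<^sup>i)) \<cong> F(x\<^sup>i)\<close> acts on elements: those of sort
  \<open>i\<close> in \<open>F(X)\<close> are the homomorphisms \<open>F(x\<^sup>i) \<rightarrow> F(X)\<close>, so \<open>\<Phi>\<close> yields sorted bijections
  \<open>s\<^sub>X : F(X) \<rightarrow> F(\<Phi>(X))\<close> with \<open>\<Phi>(\<mu>) = s\<^sub>Y \<mu> s\<^sub>X\<inverse>\<close>.  As \<open>\<Phi>\<close> is full and surjective on objects,
  \<open>F(\<Phi>(X))\<close> is free on \<open>s\<^sub>X(X)\<close>.  Hence, up to an isomorphism, \<open>s\<^sub>X\<close> becomes a bijection \<open>t\<^sub>X\<close> of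
  \<open>F(X)\<close> that fixes \<open>X\<close>, and the words \<open>w\<^sub>\<omega> = t(\<omega>(x\<^sub>1, \<dots>, x\<^sub>n))\<close> make \<open>t\<^sub>X\<close> an isomorphism of \<open>F(X)\<close>
  onto its algebra of verbal operations.  Conversely, isomorphisms \<open>s\<^sub>X\<close> as in Op2 define an
  automorphism \<open>\<mu> \<mapsto> s\<^sub>Y \<mu> s\<^sub>X\<inverse>\<close> that is the identity on objects.

  The homomorphisms from \<open>F(X)\<close> to \<open>H\<^sub>W\<^sup>*\<close> are exactly the \<open>\<phi> t\<^sub>X\<close> with \<open>\<phi> : F(X) \<rightarrow> H\<close>, so \<open>T\<close> is
  closed over \<open>H\<^sub>W\<^sup>*\<close> if and only if \<open>t\<^sub>X(T)\<close> is closed over \<open>H\<close>.  The bijections of closed sets in an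
  automorphic equivalence are forced to be \<open>T \<mapsto> s\<^sub>X(T)\<close>, by testing them on pairs of homomorphisms
  from the \<open>F(x\<^sup>i)\<close>.  Finally, geometric equivalence says that the closed sets coincide.\<close>

section \<open>Homomorphisms and isomorphisms of many-sorted algebras\<close>

lemma component_iff: "a \<in> component A i \<longleftrightarrow> a \<in> elems A \<and> srt A a = i"
  by (auto simp: component_def)

lemma hom_component: "\<phi> \<in> hom \<Sigma> A B \<Longrightarrow> a \<in> component A i \<Longrightarrow> \<phi> a \<in> component B i"
  by (auto simp: hom_def component_def)

lemma hom_elems: "\<phi> \<in> hom \<Sigma> A B \<Longrightarrow> a \<in> elems A \<Longrightarrow> \<phi> a \<in> elems B"
  by (auto simp: hom_def)

lemma hom_srt: "\<phi> \<in> hom \<Sigma> A B \<Longrightarrow> a \<in> elems A \<Longrightarrow> srt B (\<phi> a) = srt A a"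
  by (auto simp: hom_def)

lemma hom_interp:
  "\<phi> \<in> hom \<Sigma> A B \<Longrightarrow> \<omega> \<in> ops \<Sigma> \<Longrightarrow> as \<in> args A (arity \<Sigma> \<omega>) \<Longrightarrow>
    \<phi> (interp A \<omega> as) = interp B \<omega> (map \<phi> as)"
  by (auto simp: hom_def)

lemma hom_eqI:
  "\<phi> \<in> hom \<Sigma> A B \<Longrightarrow> \<psi> \<in> hom \<Sigma> A B \<Longrightarrow> (\<And>a. a \<in> elems A \<Longrightarrow> \<phi> a = \<psi> a) \<Longrightarrow> \<phi> = \<psi>"
  by (auto simp: hom_def intro: PiE_ext)

lemma args_set: "as \<in> args A is \<Longrightarrow> set as \<subseteq> elems A"
  by (force simp: args_def list_all2_conv_all_nth in_set_conv_nth component_def)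

lemma args_map:
  assumes "as \<in> args A is" and "\<And>a. a \<in> elems A \<Longrightarrow> f a \<in> component B (srt A a)"
  shows "map f as \<in> args B is"
  using assms by (auto simp: args_def list_all2_conv_all_nth component_def)

lemma hom_args: "\<phi> \<in> hom \<Sigma> A B \<Longrightarrow> as \<in> args A is \<Longrightarrow> map \<phi> as \<in> args B is"
  by (rule args_map) (auto simp: component_def hom_def)

lemma algebra_interp:
  "algebra \<Sigma> A \<Longrightarrow> \<omega> \<in> ops \<Sigma> \<Longrightarrow> as \<in> args A (arity \<Sigma> \<omega>) \<Longrightarrow>
    interp A \<omega> as \<in> component A (result \<Sigma> \<omega>)"
  by (auto simp: algebra_def)

lemma algebra_srt: "algebra \<Sigma> A \<Longrightarrow> a \<in> elems A \<Longrightarrow> srt A a \<in> sorts \<Sigma>"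
  by (auto simp: algebra_def)

lemma hom_compose:
  assumes A: "algebra \<Sigma> A" and \<phi>: "\<phi> \<in> hom \<Sigma> A B" and \<psi>: "\<psi> \<in> hom \<Sigma> B D"
  shows "compose (elems A) \<psi> \<phi> \<in> hom \<Sigma> A D"
proof -
  have "compose (elems A) \<psi> \<phi> (interp A \<omega> as) = interp D \<omega> (map (compose (elems A) \<psi> \<phi>) as)"
    if \<omega>: "\<omega> \<in> ops \<Sigma>" and as: "as \<in> args A (arity \<Sigma> \<omega>)" for \<omega> as
  proof -
    have "interp A \<omega> as \<in> elems A"
      using algebra_interp[OF A \<omega> as] by (simp add: component_iff)
    then have "compose (elems A) \<psi> \<phi> (interp A \<omega> as) = \<psi> (interp B \<omega> (map \<phi> as))"
      by (simp add: compose_eq hom_interp[OF \<phi> \<omega> as])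
    also have "\<dots> = interp D \<omega> (map \<psi> (map \<phi> as))"
      by (rule hom_interp[OF \<psi> \<omega> hom_args[OF \<phi> as]])
    also have "map \<psi> (map \<phi> as) = map (compose (elems A) \<psi> \<phi>) as"
      using args_set[OF as] by (auto simp: compose_eq subset_iff)
    finally show ?thesis .
  qed
  moreover have "srt D (\<psi> (\<phi> a)) = srt A a" if "a \<in> elems A" for a
    using hom_srt[OF \<psi> hom_elems[OF \<phi> that]] hom_srt[OF \<phi> that] by simp
  ultimately show ?thesis
    using hom_elems[OF \<phi>] hom_elems[OF \<psi>] by (auto simp: hom_def compose_def)
qed

lemma hom_id:
  assumes A: "algebra \<Sigma> A"
  shows "(\<lambda>a\<in>elems A. a) \<in> hom \<Sigma> A A"
proof -
  have "interp A \<omega> as \<in> elems A" "map (\<lambda>a\<in>elems A. a) as = as"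
    if "\<omega> \<in> ops \<Sigma>" and "as \<in> args A (arity \<Sigma> \<omega>)" for \<omega> as
    using algebra_interp[OF A that] args_set[OF that(2)]
    by (auto simp: component_iff subset_iff intro!: map_idI)
  then show ?thesis
    by (auto simp: hom_def)
qed

lemma iso_inverse:
  assumes B: "algebra \<Sigma> B" and A: "algebra \<Sigma> A" and \<phi>: "\<phi> \<in> iso \<Sigma> A B"
  obtains \<psi> where "\<psi> \<in> iso \<Sigma> B A" "\<And>a. a \<in> elems A \<Longrightarrow> \<psi> (\<phi> a) = a"
    "\<And>b. b \<in> elems B \<Longrightarrow> \<phi> (\<psi> b) = b"
proof -
  have h: "\<phi> \<in> hom \<Sigma> A B" and bij: "bij_betw \<phi> (elems A) (elems B)"
    using \<phi> by (auto simp: iso_def)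
  \<comment> \<open>\<open>hom\<close> consists of extensional functions, so the inverse is cut off
    outside \<open>B\<close>.\<close>
  define \<psi> where "\<psi> = (\<lambda>b\<in>elems B. inv_into (elems A) \<phi> b)"
  have l: "\<psi> (\<phi> a) = a" if "a \<in> elems A" for a
    using that bij hom_elems[OF h that] by (simp add: \<psi>_def bij_betw_inv_into_left)
  have r: "\<phi> (\<psi> b) = b" and e: "\<psi> b \<in> elems A" if "b \<in> elems B" for b
    using that bij by (auto simp: \<psi>_def bij_betw_inv_into_right bij_betw_def inv_into_into)
  have s: "srt A (\<psi> b) = srt B b" if "b \<in> elems B" for b
    using hom_srt[OF h e[OF that]] r[OF that] by simp
  have "\<psi> (interp B \<omega> bs) = interp A \<omega> (map \<psi> bs)"
    if \<omega>: "\<omega> \<in> ops \<Sigma>" and bs: "bs \<in> args B (arity \<Sigma> \<omega>)" for \<omega> bs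
  proof -
    have as: "map \<psi> bs \<in> args A (arity \<Sigma> \<omega>)"
      by (rule args_map[OF bs]) (simp add: component_iff e s)
    have "map \<phi> (map \<psi> bs) = bs"
      using args_set[OF bs] by (auto simp: r subset_iff intro!: map_idI)
    then have "\<phi> (interp A \<omega> (map \<psi> bs)) = interp B \<omega> bs"
      using hom_interp[OF h \<omega> as] by simp
    then show ?thesis
      using l algebra_interp[OF A \<omega> as] by (metis component_iff)
  qed
  moreover have "\<psi> \<in> extensional (elems B)"
    by (simp add: \<psi>_def)
  ultimately have "\<psi> \<in> hom \<Sigma> B A"
    by (simp add: hom_def PiE_def e s)
  moreover have "bij_betw \<psi> (elems B) (elems A)"
    by (rule bij_betw_byWitness[where f' = \<phi>]) (use l r e hom_elems[OF h] in auto)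
  ultimately have "\<psi> \<in> iso \<Sigma> B A"
    by (simp add: iso_def)
  from this l r show ?thesis
    by (rule that)
qed

section \<open>Free algebras of a variety\<close>

text \<open>The values \<open>f x\<close> themselves show that the sorts of the generators occur in
  \<open>B\<close>, so the sort condition in \<open>free_on\<close> is met. This is the existence
  half of the universal property.\<close>

lemma free_on_extend:
  assumes "free_on \<Sigma> \<Theta> A X" and "B \<in> \<Theta>" and "\<And>x. x \<in> X \<Longrightarrow> f x \<in> component B (srt A x)"
  obtains \<phi> where "\<phi> \<in> hom \<Sigma> A B" "\<And>x. x \<in> X \<Longrightarrow> \<phi> x = f x"
proof -
  have "srt A ` X \<subseteq> srt B ` elems B"
    using assms(3) by (force simp: component_iff)
  then show ?thesis
    using assms that unfolding free_on_def by metis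
qed

lemma variety_algebra: "A \<in> variety \<Sigma> E \<Longrightarrow> algebra \<Sigma> A"
  by (simp add: variety_def)

text \<open>Every homomorphism from a term algebra into the subalgebra is also one into
  \<open>A\<close>, so the identities are inherited.\<close>

lemma subalgebra_variety:
  assumes A: "A \<in> variety \<Sigma> E" and S: "S \<subseteq> elems A"
    and closed: "\<And>\<omega> as. \<omega> \<in> ops \<Sigma> \<Longrightarrow> as \<in> args A (arity \<Sigma> \<omega>) \<Longrightarrow> set as \<subseteq> S \<Longrightarrow> interp A \<omega> as \<in> S"
  shows "A\<lparr>elems := S\<rparr> \<in> variety \<Sigma> E"
proof -
  have args: "as \<in> args A is \<and> set as \<subseteq> S" if "as \<in> args (A\<lparr>elems := S\<rparr>) is" for as "is"
    using that S args_set[OF that] by (auto simp: args_def component_def list_all2_conv_all_nth)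
  have "algebra \<Sigma> (A\<lparr>elems := S\<rparr>)"
    using variety_algebra[OF A] S closed args by (fastforce simp: algebra_def component_iff)
  moreover have "\<phi> \<in> hom \<Sigma> D A" if "\<phi> \<in> hom \<Sigma> D (A\<lparr>elems := S\<rparr>)"
    for \<phi> and D :: "('a, 'b, ('b, 'a \<times> 'd) trm) alg"
    using that S by (auto simp: hom_def PiE_iff)
  ultimately show ?thesis
    using A unfolding variety_def satisfies_def by fastforce
qed

text \<open>Freeness implies generation: \<open>S\<close> carries a subalgebra in the variety, so
  the inclusion of \<open>X\<close> extends to a homomorphism from \<open>A\<close> into it. As an
  endomorphism of \<open>A\<close> it fixes \<open>X\<close>, hence is the identity by
  uniqueness.\<close>

lemma free_on_induct:
  assumes free: "free_on \<Sigma> (variety \<Sigma> E) A X" and S: "X \<subseteq> S" "S \<subseteq> elems A"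
    and closed: "\<And>\<omega> as. \<omega> \<in> ops \<Sigma> \<Longrightarrow> as \<in> args A (arity \<Sigma> \<omega>) \<Longrightarrow> set as \<subseteq> S \<Longrightarrow> interp A \<omega> as \<in> S"
  shows "S = elems A"
proof -
  let ?B = "A\<lparr>elems := S\<rparr>"
  have A: "A \<in> variety \<Sigma> E" and X: "X \<subseteq> elems A"
    using free by (auto simp: free_on_def)
  obtain \<phi> where \<phi>: "\<phi> \<in> hom \<Sigma> A ?B" "\<And>x. x \<in> X \<Longrightarrow> \<phi> x = x"
    using free_on_extend[OF free subalgebra_variety[OF A S(2) closed], of "\<lambda>x. x"] S(1)
    by (auto simp: component_iff)
  have "\<phi> \<in> hom \<Sigma> A A"
    using \<phi>(1) S(2) by (auto simp: hom_def PiE_iff)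
  moreover have "\<exists>!\<phi>. \<phi> \<in> hom \<Sigma> A A \<and> (\<forall>x\<in>X. \<phi> x = x)"
    using free A X image_mono[OF X, of "srt A"] unfolding free_on_def
    by (elim conjE ballE[of _ _ A] impE allE[of _ "\<lambda>x. x"]) (auto simp: component_iff)
  ultimately have "\<phi> = (\<lambda>a\<in>elems A. a)"
    using \<phi>(2) hom_id[OF variety_algebra[OF A]] X by (metis restrict_apply' subsetD)
  then have "a \<in> S" if "a \<in> elems A" for a
    using hom_elems[OF \<phi>(1) that] that by simp
  with S(2) show ?thesis by blast
qed

text \<open>The equaliser of the two maps contains \<open>X\<close> and is closed under the
  operations, so it is all of \<open>A\<close>. Unlike the uniqueness in \<open>free_on\<close>,
  this covers targets not known to lie in the variety, such as algebras of verbal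
  operations.\<close>

lemma free_on_hom_eq:
  assumes free: "free_on \<Sigma> (variety \<Sigma> E) A X"
    and \<phi>: "\<phi> \<in> hom \<Sigma> A B" and \<psi>: "\<psi> \<in> hom \<Sigma> A B" and eq: "\<And>x. x \<in> X \<Longrightarrow> \<phi> x = \<psi> x"
  shows "\<phi> = \<psi>"
proof -
  have A: "algebra \<Sigma> A" and X: "X \<subseteq> elems A"
    using free by (auto simp: free_on_def variety_def)
  have "{a \<in> elems A. \<phi> a = \<psi> a} = elems A"
  proof (rule free_on_induct[OF free])
    fix \<omega> as
    assume \<omega>: "\<omega> \<in> ops \<Sigma>" and as: "as \<in> args A (arity \<Sigma> \<omega>)" and "set as \<subseteq> {a \<in> elems A. \<phi> a = \<psi> a}"
    then have "map \<phi> as = map \<psi> as" by auto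
    with algebra_interp[OF A \<omega> as] hom_interp[OF \<phi> \<omega> as] hom_interp[OF \<psi> \<omega> as]
    show "interp A \<omega> as \<in> {a \<in> elems A. \<phi> a = \<psi> a}"
      by (simp add: component_iff)
  qed (use X eq in auto)
  with \<phi> \<psi> show ?thesis
    by (intro hom_eqI) auto
qed

text \<open>Composing with the inverse isomorphism carries the universal property over. This will
  supply a free generator for the image of a one-generator algebra under an automorphism of the
  category.\<close>

lemma free_on_iso:
  fixes A B :: "('s, 'o, 'a) alg"
  assumes free: "free_on \<Sigma> (variety \<Sigma> E) A X" and B: "B \<in> variety \<Sigma> E" and \<phi>: "\<phi> \<in> iso \<Sigma> A B"
  shows "free_on \<Sigma> (variety \<Sigma> E) B (\<phi> ` X)"
proof -
  have A: "A \<in> variety \<Sigma> E" and X: "X \<subseteq> elems A"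
    using free by (auto simp: free_on_def)
  have h: "\<phi> \<in> hom \<Sigma> A B"
    using \<phi> by (auto simp: iso_def)
  obtain \<psi> where \<psi>': "\<psi> \<in> iso \<Sigma> B A" and \<psi>: "\<And>a. a \<in> elems A \<Longrightarrow> \<psi> (\<phi> a) = a"
    "\<And>b. b \<in> elems B \<Longrightarrow> \<phi> (\<psi> b) = b"
    using iso_inverse[OF variety_algebra[OF B] variety_algebra[OF A] \<phi>] by blast
  have \<psi>h: "\<psi> \<in> hom \<Sigma> B A"
    using \<psi>' by (simp add: iso_def)
  have univ: "\<exists>!\<theta>. \<theta> \<in> hom \<Sigma> B D \<and> (\<forall>y\<in>\<phi> ` X. \<theta> y = f y)"
    if D: "D \<in> variety \<Sigma> E" and f: "\<forall>y\<in>\<phi> ` X. f y \<in> component D (srt B y)"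
    for D :: "('s, 'o, 'a) alg" and f
  proof -
    have "f (\<phi> x) \<in> component D (srt A x)" if "x \<in> X" for x
      using f that hom_srt[OF h subsetD[OF X that]] by auto
    then obtain \<alpha> where \<alpha>: "\<alpha> \<in> hom \<Sigma> A D" "\<And>x. x \<in> X \<Longrightarrow> \<alpha> x = f (\<phi> x)"
      using free_on_extend[OF free D, of "\<lambda>x. f (\<phi> x)"] by blast
    show ?thesis
    proof (rule ex1I)
      show "compose (elems B) \<alpha> \<psi> \<in> hom \<Sigma> B D \<and> (\<forall>y\<in>\<phi> ` X. compose (elems B) \<alpha> \<psi> y = f y)"
        using hom_compose[OF variety_algebra[OF B] \<psi>h \<alpha>(1)] X \<alpha>(2) \<psi>(1) hom_elems[OF h]
        by (auto simp: compose_eq subset_iff)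
    next
      fix \<theta>
      assume \<theta>: "\<theta> \<in> hom \<Sigma> B D \<and> (\<forall>y\<in>\<phi> ` X. \<theta> y = f y)"
      have "compose (elems A) \<theta> \<phi> = \<alpha>"
        using \<theta> X \<alpha> hom_compose[OF variety_algebra[OF A] h, of \<theta> D]
        by (intro free_on_hom_eq[OF free]) (auto simp: compose_eq subset_iff)
      then have "\<alpha> (\<psi> b) = \<theta> b" if "b \<in> elems B" for b
        using \<psi>(2)[OF that] hom_elems[OF \<psi>h that] by (metis compose_eq)
      then show "\<theta> = compose (elems B) \<alpha> \<psi>"
        using \<theta> hom_compose[OF variety_algebra[OF B] \<psi>h \<alpha>(1)]
        by (intro hom_eqI) (auto simp: compose_eq)
    qed
  qed
  show ?thesis
    unfolding free_on_def
  proof (intro conjI ballI impI allI)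
    show "\<phi> ` X \<subseteq> elems B"
      using X hom_elems[OF h] by auto
  qed (use B univ in auto)
qed


section \<open>Algebraically closed sets of pairs\<close>

lemma sorted_pairs_iff:
  "(a, b) \<in> sorted_pairs A \<longleftrightarrow> a \<in> elems A \<and> b \<in> elems A \<and> srt A a = srt A b"
  by (auto simp: sorted_pairs_def component_def)

lemma alg_closure_ker_iff:
  "p \<in> alg_closure \<Sigma> H A T \<longleftrightarrow>
    p \<in> sorted_pairs A \<and> (\<forall>\<phi>\<in>hom \<Sigma> A H. T \<subseteq> ker A \<phi> \<longrightarrow> p \<in> ker A \<phi>)"
  unfolding alg_closure_def by blast

lemma alg_closure_iff:
  fixes H :: "('s, 'o, 'b) alg" and A :: "('s, 'o, 'a) alg"
  assumes "T \<subseteq> sorted_pairs A"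
  shows "(a, b) \<in> alg_closure \<Sigma> H A T \<longleftrightarrow> (a, b) \<in> sorted_pairs A \<and>
    (\<forall>\<phi>\<in>hom \<Sigma> A H. (\<forall>(c, d)\<in>T. \<phi> c = \<phi> d) \<longrightarrow> \<phi> a = \<phi> b)"
proof -
  have "T \<subseteq> ker A \<phi> \<longleftrightarrow> (\<forall>(c, d)\<in>T. \<phi> c = \<phi> d)" for \<phi> :: "'a \<Rightarrow> 'b"
    using assms by (auto simp: ker_def sorted_pairs_iff)
  then show ?thesis
    by (auto simp: alg_closure_ker_iff ker_def sorted_pairs_iff)
qed

lemma alg_closure_sorted: "alg_closure \<Sigma> H A T \<subseteq> sorted_pairs A"
  by (auto simp: alg_closure_ker_iff)

lemma alg_closure_extensive: "T \<subseteq> sorted_pairs A \<Longrightarrow> T \<subseteq> alg_closure \<Sigma> H A T"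
  by (auto simp: alg_closure_ker_iff)

lemma alg_closure_mono: "T \<subseteq> S \<Longrightarrow> alg_closure \<Sigma> H A T \<subseteq> alg_closure \<Sigma> H A S"
  by (auto simp: alg_closure_ker_iff)

lemma alg_closure_in_Cl: "T \<subseteq> sorted_pairs A \<Longrightarrow> alg_closure \<Sigma> H A T \<in> Cl \<Sigma> H A"
  using alg_closure_sorted[of \<Sigma> H A T] alg_closure_extensive[of T A \<Sigma> H]
  by (auto simp: Cl_def alg_closure_ker_iff[of _ \<Sigma> H A "alg_closure \<Sigma> H A T"])
    (auto simp: alg_closure_ker_iff)

text \<open>A closure operator is recovered from its closed sets: if these coincide, the closure of
  \<open>T\<close> over \<open>H'\<close> is a set closed over \<open>H\<close> that contains
  \<open>T\<close>, so it contains the closure of \<open>T\<close> over \<open>H\<close>.\<close>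

lemma geom_equiv_iff_Cl:
  "geom_equiv \<Sigma> F C H\<^sub>1 H\<^sub>2 \<longleftrightarrow> (\<forall>X\<in>C. Cl \<Sigma> H\<^sub>1 (F X) = Cl \<Sigma> H\<^sub>2 (F X))"
proof
  assume R: "\<forall>X\<in>C. Cl \<Sigma> H\<^sub>1 (F X) = Cl \<Sigma> H\<^sub>2 (F X)"
  have "alg_closure \<Sigma> H (F X) T \<subseteq> alg_closure \<Sigma> H' (F X) T"
    if eq: "Cl \<Sigma> H (F X) = Cl \<Sigma> H' (F X)" and T: "T \<subseteq> sorted_pairs (F X)"
    for X T and H H' :: "('a, 'b, 'c) alg"
  proof -
    have "alg_closure \<Sigma> H' (F X) T \<in> Cl \<Sigma> H (F X)"
      using alg_closure_in_Cl[OF T] eq by blast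
    then show ?thesis
      using alg_closure_mono[OF alg_closure_extensive[OF T, of \<Sigma> H'], of \<Sigma> H "F X"] by (simp add: Cl_def)
  qed
  then show "geom_equiv \<Sigma> F C H\<^sub>1 H\<^sub>2"
    using R unfolding geom_equiv_def by (metis subset_antisym)
qed (auto simp: geom_equiv_def Cl_def)

text \<open>Closed sets are intersections of kernels with the set of sorted pairs, hence
  equivalences. So equality of classes under \<open>nat_epi\<close> means membership in
  \<open>T\<close>.\<close>

lemma Cl_equiv: "T \<in> Cl \<Sigma> H A \<Longrightarrow> equiv (elems A) T"
proof -
  assume T: "T \<in> Cl \<Sigma> H A"
  then have sub: "T \<subseteq> sorted_pairs A" and mem: "(a, b) \<in> T \<longleftrightarrow> (a, b) \<in> sorted_pairs A \<and>
    (\<forall>\<phi>\<in>hom \<Sigma> A H. (\<forall>(c, d)\<in>T. \<phi> c = \<phi> d) \<longrightarrow> \<phi> a = \<phi> b)" for a b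
    using alg_closure_iff[of T A a b \<Sigma> H] by (auto simp: Cl_def)
  show ?thesis
  proof (rule equivI)
    show "T \<subseteq> elems A \<times> elems A"
      using sub by (auto simp: sorted_pairs_iff)
    show "refl_on (elems A) T"
      using mem by (auto simp: refl_on_def sorted_pairs_iff)
    show "sym T"
      unfolding sym_def by (subst (1 2) mem) (auto simp: sorted_pairs_iff)
    show "trans T"
      unfolding trans_def by (subst (1 2 3) mem) (auto simp: sorted_pairs_iff)
  qed
qed

lemma nat_epi_eq_iff:
  "T \<in> Cl \<Sigma> H A \<Longrightarrow> a \<in> elems A \<Longrightarrow> b \<in> elems A \<Longrightarrow> nat_epi A T a = nat_epi A T b \<longleftrightarrow> (a, b) \<in> T"
  by (simp add: nat_epi_def eq_equiv_class_iff[OF Cl_equiv])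

text \<open>\<open>T\<close> is cut out by homomorphisms \<open>\<phi>\<close> from \<open>A\<close>
  to \<open>H\<close>, and the composites of \<open>\<phi>\<close> with \<open>\<mu>\<^sub>1\<close>
  and \<open>\<mu>\<^sub>2\<close> are equal once they agree on free generators. Statements about
  natural epimorphisms thus become statements about pairs, without forming the quotient as an
  algebra.\<close>

lemma compose_nat_epi_eq_iff:
  assumes T: "T \<in> Cl \<Sigma> H A" and free: "free_on \<Sigma> (variety \<Sigma> E) D X"
    and \<mu>: "\<mu>\<^sub>1 \<in> hom \<Sigma> D A" "\<mu>\<^sub>2 \<in> hom \<Sigma> D A"
  shows "compose (elems D) (nat_epi A T) \<mu>\<^sub>1 = compose (elems D) (nat_epi A T) \<mu>\<^sub>2 \<longleftrightarrow>
    (\<forall>x\<in>X. (\<mu>\<^sub>1 x, \<mu>\<^sub>2 x) \<in> T)"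
proof -
  have D: "algebra \<Sigma> D" and X: "X \<subseteq> elems D"
    using free by (auto simp: free_on_def variety_def)
  have sub: "T \<subseteq> sorted_pairs A" and mem: "(a, b) \<in> T \<longleftrightarrow> (a, b) \<in> sorted_pairs A \<and>
    (\<forall>\<phi>\<in>hom \<Sigma> A H. (\<forall>(c, d)\<in>T. \<phi> c = \<phi> d) \<longrightarrow> \<phi> a = \<phi> b)" for a b
    using T alg_closure_iff[of T A a b \<Sigma> H] by (auto simp: Cl_def)
  have "(\<mu>\<^sub>1 d, \<mu>\<^sub>2 d) \<in> T" if gen: "\<forall>x\<in>X. (\<mu>\<^sub>1 x, \<mu>\<^sub>2 x) \<in> T" and d: "d \<in> elems D" for d
  proof (subst mem, intro conjI ballI impI)
    show "(\<mu>\<^sub>1 d, \<mu>\<^sub>2 d) \<in> sorted_pairs A"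
      using \<mu> d by (simp add: sorted_pairs_iff hom_elems hom_srt)
  next
    fix \<phi>
    assume \<phi>: "\<phi> \<in> hom \<Sigma> A H" "\<forall>(c, d)\<in>T. \<phi> c = \<phi> d"
    have "compose (elems D) \<phi> \<mu>\<^sub>1 = compose (elems D) \<phi> \<mu>\<^sub>2"
      by (rule free_on_hom_eq[OF free hom_compose[OF D \<mu>(1) \<phi>(1)] hom_compose[OF D \<mu>(2) \<phi>(1)]])
        (use gen \<phi>(2) X in \<open>auto simp: compose_eq subset_iff\<close>)
    then show "\<phi> (\<mu>\<^sub>1 d) = \<phi> (\<mu>\<^sub>2 d)"
      using d by (metis compose_eq)
  qed
  moreover have "compose (elems D) (nat_epi A T) \<mu>\<^sub>1 = compose (elems D) (nat_epi A T) \<mu>\<^sub>2 \<longleftrightarrow>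
    (\<forall>d\<in>elems D. (\<mu>\<^sub>1 d, \<mu>\<^sub>2 d) \<in> T)"
    using nat_epi_eq_iff[OF T] hom_elems[OF \<mu>(1)] hom_elems[OF \<mu>(2)]
    by (auto simp: compose_def restrict_def fun_eq_iff)
  ultimately show ?thesis
    using X by blast
qed

text \<open>Covers both an isomorphism \<open>f\<close> (with \<open>K = H\<close>) and the passage from \<open>H\<close> to the
  algebra of verbal operations \<open>K\<close>.\<close>

lemma Cl_transfer:
  fixes A :: "('s, 'o, 'a) alg" and B :: "('s, 'o, 'b) alg" and K H :: "('s, 'o, 'c) alg"
  assumes bij: "bij_betw f (elems A) (elems B)" and srt: "\<And>a. a \<in> elems A \<Longrightarrow> srt B (f a) = srt A a"
    and homs: "hom \<Sigma> A K = (\<lambda>\<phi>. compose (elems A) \<phi> f) ` hom \<Sigma> B H"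
    and T: "T \<subseteq> sorted_pairs A"
  shows "T \<in> Cl \<Sigma> K A \<longleftrightarrow> map_prod f f ` T \<in> Cl \<Sigma> H B"
proof -
  have f: "f a \<in> elems B" if "a \<in> elems A" for a
    using bij that by (auto simp: bij_betw_def)
  have inj: "inj_on (map_prod f f) (sorted_pairs A)"
    using bij by (auto simp: inj_on_def bij_betw_def sorted_pairs_iff)
  have fT: "map_prod f f ` T \<subseteq> sorted_pairs B"
    using T f srt by (force simp: sorted_pairs_iff)
  have hT: "(\<forall>(c, d)\<in>map_prod f f ` T. \<phi> c = \<phi> d) \<longleftrightarrow>
      (\<forall>(c, d)\<in>T. compose (elems A) \<phi> f c = compose (elems A) \<phi> f d)" for \<phi> :: "'b \<Rightarrow> 'c"
    using T by (fastforce simp: sorted_pairs_iff compose_eq)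
  have cl: "(f a, f b) \<in> alg_closure \<Sigma> H B (map_prod f f ` T) \<longleftrightarrow> (a, b) \<in> alg_closure \<Sigma> K A T"
    if "a \<in> elems A" "b \<in> elems A" for a b
  proof -
    have "(\<forall>\<psi>\<in>hom \<Sigma> A K. (\<forall>(c, d)\<in>T. \<psi> c = \<psi> d) \<longrightarrow> \<psi> a = \<psi> b) \<longleftrightarrow>
        (\<forall>\<phi>\<in>hom \<Sigma> B H. (\<forall>(c, d)\<in>map_prod f f ` T. \<phi> c = \<phi> d) \<longrightarrow> \<phi> (f a) = \<phi> (f b))"
      unfolding homs hT using that by (simp add: compose_eq)
    then show ?thesis
      unfolding alg_closure_iff[OF fT] alg_closure_iff[OF T]
      using that f srt by (simp add: sorted_pairs_iff)
  qed
  \<comment> \<open>Closures correspond under \<open>f\<close>; since \<open>map_prod f f\<close> is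
    injective on sorted pairs, being closed then corresponds as well.\<close>
  have "map_prod f f ` alg_closure \<Sigma> K A T = alg_closure \<Sigma> H B (map_prod f f ` T)"
  proof (intro subset_antisym subsetI)
    fix q assume q: "q \<in> alg_closure \<Sigma> H B (map_prod f f ` T)"
    then have "q \<in> f ` elems A \<times> f ` elems A"
      unfolding bij_betw_imp_surj_on[OF bij] using alg_closure_sorted[of \<Sigma> H B "map_prod f f ` T"] by (cases q) (auto simp: sorted_pairs_iff)
    then obtain a b where "q = (f a, f b)" "a \<in> elems A" "b \<in> elems A"
      by blast
    then show "q \<in> map_prod f f ` alg_closure \<Sigma> K A T"
      using cl q by force
  next
    fix q assume "q \<in> map_prod f f ` alg_closure \<Sigma> K A T"
    then obtain a b where "q = (f a, f b)" "(a, b) \<in> alg_closure \<Sigma> K A T"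
      by auto
    then show "q \<in> alg_closure \<Sigma> H B (map_prod f f ` T)"
      using cl alg_closure_sorted[of \<Sigma> K A T] by (auto simp: sorted_pairs_iff subset_iff)
  qed
  then show ?thesis
    using inj_on_image_eq_iff[OF inj alg_closure_sorted[of \<Sigma> K A T] T] T fT by (simp add: Cl_def)
qed

section \<open>Verbal operations and systems of words\<close>

lemma verbal_map:
  assumes free: "free_on \<Sigma> (variety \<Sigma> E) A (set xs)" and \<alpha>: "\<alpha> \<in> hom \<Sigma> A H"
  shows "verbal \<Sigma> A xs w H (map \<alpha> xs) = \<alpha> w"
proof -
  have "(THE \<beta>. \<beta> \<in> hom \<Sigma> A H \<and> map \<beta> xs = map \<alpha> xs) = \<alpha>"
    using \<alpha> by (intro the_equality free_on_hom_eq[OF free]) auto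
  then show ?thesis
    by (simp add: verbal_def)
qed

lemma free_on_extend_list:
  fixes A H :: "('s, 'o, 'a) alg"
  assumes free: "free_on \<Sigma> (variety \<Sigma> E) A (set xs)" and "distinct xs"
    and H: "H \<in> variety \<Sigma> E" and hs: "hs \<in> args H (map (srt A) xs)"
  obtains \<alpha> where "\<alpha> \<in> hom \<Sigma> A H" "map \<alpha> xs = hs"
proof -
  have len: "length hs = length xs" and comp: "\<And>k. k < length xs \<Longrightarrow> hs ! k \<in> component H (srt A (xs ! k))"
    using hs by (auto simp: args_def list_all2_conv_all_nth)
  \<comment> \<open>As \<open>xs\<close> has no repetitions, this sends \<open>xs ! k\<close> to
    \<open>hs ! k\<close>; other points carry an arbitrary value.\<close>
  define f where "f x = the (map_of (zip xs hs) x)" for x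
  have f: "f (xs ! k) = hs ! k" if "k < length xs" for k
    using that len \<open>distinct xs\<close> by (simp add: f_def map_of_zip_nth)
  have "f x \<in> component H (srt A x)" if "x \<in> set xs" for x
    using that comp f by (auto simp: in_set_conv_nth)
  then obtain \<alpha> where \<alpha>: "\<alpha> \<in> hom \<Sigma> A H" "\<And>x. x \<in> set xs \<Longrightarrow> \<alpha> x = f x"
    using free_on_extend[OF free H, of f] by blast
  moreover have "map \<alpha> xs = hs"
    using \<alpha>(2) f len by (auto intro: nth_equalityI)
  ultimately show ?thesis
    using that by blast
qed

lemma args_gens: "set as \<subseteq> elems A \<Longrightarrow> as \<in> args A (map (srt A) as)"
  by (auto simp: args_def list_all2_conv_all_nth component_iff)

lemma verbal_alg_simps [simp]:
  "elems (verbal_alg \<Sigma> F xs W H) = elems H"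
  "srt (verbal_alg \<Sigma> F xs W H) = srt H"
  "interp (verbal_alg \<Sigma> F xs W H) \<omega> = verbal \<Sigma> (F (set (xs \<omega>))) (xs \<omega>) (W \<omega>) H"
  "component (verbal_alg \<Sigma> F xs W H) = component H"
  "args (verbal_alg \<Sigma> F xs W H) = args H"
  by (auto simp: verbal_alg_def component_def args_def fun_eq_iff)

text \<open>The locale keeps what the argument uses of the category: each \<open>X\<close> in
  \<open>C\<close> freely generates \<open>F X\<close>, and the list \<open>xs \<omega>\<close> has
  the sorts of the arguments of \<open>\<omega>\<close>, so argument tuples are the sort-preserving
  assignments to these generators.\<close>

locale free_category =
  fixes \<Sigma> :: "('s, 'o) signature"
    and E :: "(('o, 's \<times> 'v) trm \<times> ('o, 's \<times> 'v) trm) set"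
    and F :: "'a set \<Rightarrow> ('s, 'o, 'a) alg" and C :: "'a set set" and xs :: "'o \<Rightarrow> 'a list"
  assumes free: "X \<in> C \<Longrightarrow> free_on \<Sigma> (variety \<Sigma> E) (F X) X"
    and gens: "\<omega> \<in> ops \<Sigma> \<Longrightarrow> distinct (xs \<omega>) \<and> set (xs \<omega>) \<in> C \<and>
      map (srt (F (set (xs \<omega>)))) (xs \<omega>) = arity \<Sigma> \<omega>"
begin

lemma in_variety: "X \<in> C \<Longrightarrow> F X \<in> variety \<Sigma> E"
  and gens_elems: "X \<in> C \<Longrightarrow> x \<in> X \<Longrightarrow> x \<in> elems (F X)"
  using free by (auto simp: free_on_def)

lemma alg: "X \<in> C \<Longrightarrow> algebra \<Sigma> (F X)"
  by (rule variety_algebra[OF in_variety])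

text \<open>If \<open>\<alpha>\<close> sends the generators to the arguments, then
  \<open>\<phi>\<close> after \<open>\<alpha>\<close> sends them to the images of the arguments;
  evaluate both at the word.\<close>

lemma verbal_hom:
  assumes "Op1 \<Sigma> F xs W" and H: "H \<in> variety \<Sigma> E" and \<phi>: "\<phi> \<in> hom \<Sigma> H K"
  shows "\<phi> \<in> hom \<Sigma> (verbal_alg \<Sigma> F xs W H) (verbal_alg \<Sigma> F xs W K)"
proof -
  have "\<phi> (verbal \<Sigma> (F (set (xs \<omega>))) (xs \<omega>) (W \<omega>) H hs) =
      verbal \<Sigma> (F (set (xs \<omega>))) (xs \<omega>) (W \<omega>) K (map \<phi> hs)"
    if \<omega>: "\<omega> \<in> ops \<Sigma>" and hs: "hs \<in> args H (arity \<Sigma> \<omega>)" for \<omega> hs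
  proof -
    let ?A = "F (set (xs \<omega>))"
    have w: "W \<omega> \<in> elems ?A" and dist: "distinct (xs \<omega>)" and A: "set (xs \<omega>) \<in> C"
      using assms(1) \<omega> gens[OF \<omega>] by (auto simp: Op1_def)
    have "hs \<in> args H (map (srt ?A) (xs \<omega>))"
      using hs gens[OF \<omega>] by simp
    then obtain \<alpha> where \<alpha>: "\<alpha> \<in> hom \<Sigma> ?A H" "map \<alpha> (xs \<omega>) = hs"
      using free_on_extend_list[OF free[OF A] dist H] by blast
    have "map (compose (elems ?A) \<phi> \<alpha>) (xs \<omega>) = map \<phi> hs"
      using \<alpha>(2) gens_elems[OF A] by (auto simp: compose_eq)
    with verbal_map[OF free[OF A] \<alpha>(1)] \<alpha>(2)
      verbal_map[OF free[OF A] hom_compose[OF alg[OF A] \<alpha>(1) \<phi>]]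
    show ?thesis
      using w by (metis compose_eq)
  qed
  with \<phi> show ?thesis
    by (auto simp: hom_def)
qed

text \<open>Composites with \<open>t\<close> are homomorphisms by \<open>verbal_hom\<close>.
  Conversely, let \<open>\<phi>\<close> be the homomorphism into \<open>H\<close> with the values of
  \<open>\<psi>\<close> on \<open>X\<close>; as \<open>t\<close> fixes \<open>X\<close>, the
  composite of \<open>\<phi>\<close> and \<open>t\<close> agrees with \<open>\<psi>\<close> on
  \<open>X\<close>, hence everywhere.\<close>

lemma hom_verbal_alg:
  assumes W: "Op1 \<Sigma> F xs W" and X: "X \<in> C" and H: "H \<in> variety \<Sigma> E"
    and t: "t \<in> hom \<Sigma> (F X) (verbal_alg \<Sigma> F xs W (F X))" and tX: "\<And>x. x \<in> X \<Longrightarrow> t x = x"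
  shows "hom \<Sigma> (F X) (verbal_alg \<Sigma> F xs W H) = (\<lambda>\<phi>. compose (elems (F X)) \<phi> t) ` hom \<Sigma> (F X) H"
proof -
  have *: "compose (elems (F X)) \<phi> t \<in> hom \<Sigma> (F X) (verbal_alg \<Sigma> F xs W H)" if "\<phi> \<in> hom \<Sigma> (F X) H" for \<phi>
    by (rule hom_compose[OF alg[OF X] t verbal_hom[OF W in_variety[OF X] that]])
  have "\<psi> \<in> (\<lambda>\<phi>. compose (elems (F X)) \<phi> t) ` hom \<Sigma> (F X) H"
    if \<psi>: "\<psi> \<in> hom \<Sigma> (F X) (verbal_alg \<Sigma> F xs W H)" for \<psi>
  proof -
    have "\<psi> x \<in> component H (srt (F X) x)" if "x \<in> X" for x
      using hom_component[OF \<psi>, of x] gens_elems[OF X that] by (simp add: component_iff)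
    then obtain \<phi> where \<phi>: "\<phi> \<in> hom \<Sigma> (F X) H" "\<And>x. x \<in> X \<Longrightarrow> \<phi> x = \<psi> x"
      using free_on_extend[OF free[OF X] H, of \<psi>] by blast
    have "\<psi> = compose (elems (F X)) \<phi> t"
      by (rule free_on_hom_eq[OF free[OF X] \<psi> *[OF \<phi>(1)]])
        (simp add: \<phi>(2) tX gens_elems[OF X] compose_eq)
    with \<phi>(1) show ?thesis by blast
  qed
  with * show ?thesis by blast
qed

lemma Cl_verbal_alg:
  assumes "Op1 \<Sigma> F xs W" and "X \<in> C" and "H \<in> variety \<Sigma> E"
    and t: "t \<in> iso \<Sigma> (F X) (verbal_alg \<Sigma> F xs W (F X))" and "\<And>x. x \<in> X \<Longrightarrow> t x = x"
    and T: "T \<subseteq> sorted_pairs (F X)"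
  shows "T \<in> Cl \<Sigma> (verbal_alg \<Sigma> F xs W H) (F X) \<longleftrightarrow> map_prod t t ` T \<in> Cl \<Sigma> H (F X)"
proof (rule Cl_transfer)
  show "hom \<Sigma> (F X) (verbal_alg \<Sigma> F xs W H) = (\<lambda>\<phi>. compose (elems (F X)) \<phi> t) ` hom \<Sigma> (F X) H"
    using assms by (intro hom_verbal_alg) (auto simp: iso_def)
  show "bij_betw t (elems (F X)) (elems (F X))"
    using t by (simp add: iso_def)
  show "srt (F X) (t a) = srt (F X) a" if "a \<in> elems (F X)" for a
    using t that by (simp add: iso_def hom_def)
qed (rule T)

text \<open>Every argument tuple in \<open>F X\<close> is the image of the generators
  \<open>xs \<omega>\<close> under some \<open>\<mu>\<close>, so naturality reduces each operation
  to its value at the generators. Naturality is stated as the existence of some \<open>\<nu>\<close>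
  that matches \<open>\<mu>\<close> under \<open>t\<close>.\<close>

lemma words_of_natural_bijections:
  assumes bij: "\<And>X. X \<in> C \<Longrightarrow> bij_betw (t X) (elems (F X)) (elems (F X))"
    and ext: "\<And>X. X \<in> C \<Longrightarrow> t X \<in> extensional (elems (F X))"
    and srt: "\<And>X a. X \<in> C \<Longrightarrow> a \<in> elems (F X) \<Longrightarrow> srt (F X) (t X a) = srt (F X) a"
    and tX: "\<And>X x. X \<in> C \<Longrightarrow> x \<in> X \<Longrightarrow> t X x = x"
    and nat: "\<And>X Y \<mu>. X \<in> C \<Longrightarrow> Y \<in> C \<Longrightarrow> \<mu> \<in> hom \<Sigma> (F X) (F Y) \<Longrightarrow>
      \<exists>\<nu>\<in>hom \<Sigma> (F X) (F Y). \<forall>a\<in>elems (F X). t Y (\<mu> a) = \<nu> (t X a)"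
  obtains W where "Op1 \<Sigma> F xs W" "\<And>X. X \<in> C \<Longrightarrow> t X \<in> iso \<Sigma> (F X) (verbal_alg \<Sigma> F xs W (F X))"
proof -
  \<comment> \<open>The word is the image under \<open>t\<close> of \<open>\<omega>\<close> applied
    to its generic arguments.\<close>
  define W where "W \<omega> = t (set (xs \<omega>)) (interp (F (set (xs \<omega>))) \<omega> (xs \<omega>))" for \<omega>
  have args: "xs \<omega> \<in> args (F (set (xs \<omega>))) (arity \<Sigma> \<omega>)" if \<omega>: "\<omega> \<in> ops \<Sigma>" for \<omega>
    using gens[OF \<omega>] gens_elems args_gens[of "xs \<omega>" "F (set (xs \<omega>))"] by auto
  have el: "interp (F (set (xs \<omega>))) \<omega> (xs \<omega>) \<in> elems (F (set (xs \<omega>)))" if \<omega>: "\<omega> \<in> ops \<Sigma>" for \<omega>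
    using algebra_interp[OF alg \<omega> args[OF \<omega>]] gens[OF \<omega>] by (simp add: component_iff)
  have t_el: "t X a \<in> elems (F X)" if "X \<in> C" "a \<in> elems (F X)" for X a
    using bij[OF that(1)] that(2) by (auto simp: bij_betw_def)
  have "Op1 \<Sigma> F xs W"
    using t_el el gens by (auto simp: Op1_def W_def)
  moreover have "t X \<in> iso \<Sigma> (F X) (verbal_alg \<Sigma> F xs W (F X))" if X: "X \<in> C" for X
  proof -
    have "t X (interp (F X) \<omega> as) = verbal \<Sigma> (F (set (xs \<omega>))) (xs \<omega>) (W \<omega>) (F X) (map (t X) as)"
      if \<omega>: "\<omega> \<in> ops \<Sigma>" and as: "as \<in> args (F X) (arity \<Sigma> \<omega>)" for \<omega> as
    proof -
      let ?Y = "set (xs \<omega>)"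
      have Y: "?Y \<in> C" and dist: "distinct (xs \<omega>)"
        using gens[OF \<omega>] by auto
      have "as \<in> args (F X) (map (srt (F ?Y)) (xs \<omega>))"
        using as gens[OF \<omega>] by simp
      then obtain \<mu> where \<mu>: "\<mu> \<in> hom \<Sigma> (F ?Y) (F X)" "map \<mu> (xs \<omega>) = as"
        using free_on_extend_list[OF free[OF Y] dist in_variety[OF X]] by blast
      obtain \<nu> where \<nu>: "\<nu> \<in> hom \<Sigma> (F ?Y) (F X)" "\<And>a. a \<in> elems (F ?Y) \<Longrightarrow> t X (\<mu> a) = \<nu> (t ?Y a)"
        using nat[OF Y X \<mu>(1)] by blast
      have "t X (interp (F X) \<omega> as) = t X (\<mu> (interp (F ?Y) \<omega> (xs \<omega>)))"
        using hom_interp[OF \<mu>(1) \<omega> args[OF \<omega>]] \<mu>(2) by simp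
      also have "\<dots> = \<nu> (W \<omega>)"
        using \<nu>(2)[OF el[OF \<omega>]] by (simp add: W_def)
      also have "\<dots> = verbal \<Sigma> (F ?Y) (xs \<omega>) (W \<omega>) (F X) (map \<nu> (xs \<omega>))"
        using verbal_map[OF free[OF Y] \<nu>(1)] by simp
      \<comment> \<open>At a generator \<open>x\<close>, which \<open>t ?Y\<close> fixes,
        \<open>\<nu> x\<close> is \<open>\<nu> (t ?Y x)\<close> and thus
        \<open>t X (\<mu> x)\<close>.\<close>
      also have "map \<nu> (xs \<omega>) = map (t X) as"
        using \<nu>(2) gens_elems[OF Y] tX[OF Y] \<mu>(2) by (auto simp flip: \<mu>(2))
      finally show ?thesis .
    qed
    then show ?thesis
      using bij[OF X] ext[OF X] srt[OF X] t_el[OF X] by (auto simp: iso_def hom_def PiE_def)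
  qed
  ultimately show ?thesis
    by (rule that)
qed

end

section \<open>Bijections of elements induced by an automorphism of the category\<close>

text \<open>\<open>F {p i}\<close> represents the component of sort \<open>i\<close>: homomorphisms
  from it to \<open>F X\<close> are the elements of sort \<open>i\<close> in \<open>F X\<close>. The
  generator \<open>g i\<close> makes \<open>F (\<Phi> {p i})\<close> represent the same component,
  so that \<open>\<Psi>\<close> can be read as a map of elements.\<close>

locale representable_automorphism = free_category \<Sigma> E F C xs
  for \<Sigma> :: "('s, 'o) signature"
    and E :: "(('o, 's \<times> 'v) trm \<times> ('o, 's \<times> 'v) trm) set"
    and F :: "'a set \<Rightarrow> ('s, 'o, 'a) alg" and C :: "'a set set" and xs :: "'o \<Rightarrow> 'a list" +
  fixes \<Phi> :: "'a set \<Rightarrow> 'a set" and \<Psi> :: "'a set \<Rightarrow> 'a set \<Rightarrow> ('a \<Rightarrow> 'a) \<Rightarrow> 'a \<Rightarrow> 'a"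
    and p g :: "'s \<Rightarrow> 'a"
  assumes aut: "cat_automorphism \<Sigma> F C \<Phi> \<Psi>"
    and p: "i \<in> sorts \<Sigma> \<Longrightarrow> {p i} \<in> C" "i \<in> sorts \<Sigma> \<Longrightarrow> srt (F {p i}) (p i) = i"
    and g: "i \<in> sorts \<Sigma> \<Longrightarrow> free_on \<Sigma> (variety \<Sigma> E) (F (\<Phi> {p i})) {g i}"
      "i \<in> sorts \<Sigma> \<Longrightarrow> srt (F (\<Phi> {p i})) (g i) = i"
begin

lemma \<Phi>_ob: "X \<in> C \<Longrightarrow> \<Phi> X \<in> C"
  using aut by (auto simp: cat_automorphism_def endofunctor_def)

lemma \<Phi>_surj: "X \<in> C \<Longrightarrow> \<exists>Y\<in>C. \<Phi> Y = X"
  using aut unfolding cat_automorphism_def bij_betw_def by (metis imageE)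

lemma \<Psi>_bij: "X \<in> C \<Longrightarrow> Y \<in> C \<Longrightarrow> bij_betw (\<Psi> X Y) (hom \<Sigma> (F X) (F Y)) (hom \<Sigma> (F (\<Phi> X)) (F (\<Phi> Y)))"
  using aut by (auto simp: cat_automorphism_def)

lemma \<Psi>_hom: "X \<in> C \<Longrightarrow> Y \<in> C \<Longrightarrow> \<mu> \<in> hom \<Sigma> (F X) (F Y) \<Longrightarrow> \<Psi> X Y \<mu> \<in> hom \<Sigma> (F (\<Phi> X)) (F (\<Phi> Y))"
  using \<Psi>_bij by (auto simp: bij_betw_def)

lemma \<Psi>_inj: "X \<in> C \<Longrightarrow> Y \<in> C \<Longrightarrow> \<mu> \<in> hom \<Sigma> (F X) (F Y) \<Longrightarrow> \<nu> \<in> hom \<Sigma> (F X) (F Y) \<Longrightarrow>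
    \<Psi> X Y \<mu> = \<Psi> X Y \<nu> \<Longrightarrow> \<mu> = \<nu>"
  using \<Psi>_bij by (auto simp: bij_betw_def dest: inj_onD)

lemma \<Psi>_surj:
  assumes "X \<in> C" "Y \<in> C" "\<nu> \<in> hom \<Sigma> (F (\<Phi> X)) (F (\<Phi> Y))"
  obtains \<mu> where "\<mu> \<in> hom \<Sigma> (F X) (F Y)" "\<Psi> X Y \<mu> = \<nu>"
  using \<Psi>_bij[OF assms(1,2)] assms(3) that unfolding bij_betw_def by (metis imageE)

lemma \<Psi>_id: "X \<in> C \<Longrightarrow> \<Psi> X X (\<lambda>a\<in>elems (F X). a) = (\<lambda>a\<in>elems (F (\<Phi> X)). a)"
  using aut by (simp add: cat_automorphism_def endofunctor_def)

lemma \<Psi>_compose: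
  "X \<in> C \<Longrightarrow> Y \<in> C \<Longrightarrow> Z \<in> C \<Longrightarrow> \<mu> \<in> hom \<Sigma> (F X) (F Y) \<Longrightarrow> \<nu> \<in> hom \<Sigma> (F Y) (F Z) \<Longrightarrow>
    \<Psi> X Z (compose (elems (F X)) \<nu> \<mu>) = compose (elems (F (\<Phi> X))) (\<Psi> Y Z \<nu>) (\<Psi> X Y \<mu>)"
  using aut by (simp add: cat_automorphism_def endofunctor_def)

lemma p_elem: "i \<in> sorts \<Sigma> \<Longrightarrow> p i \<in> elems (F {p i})"
  using gens_elems[OF p(1)] by simp

lemma g_elem: "i \<in> sorts \<Sigma> \<Longrightarrow> g i \<in> elems (F (\<Phi> {p i}))"
  using g(1) by (auto simp: free_on_def)

lemma srt_sorts: "X \<in> C \<Longrightarrow> a \<in> elems (F X) \<Longrightarrow> srt (F X) a \<in> sorts \<Sigma>"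
  by (rule algebra_srt[OF alg])

lemma hom_point:
  assumes "X \<in> C" "a \<in> elems (F X)"
  obtains m where "m \<in> hom \<Sigma> (F {p (srt (F X) a)}) (F X)" "m (p (srt (F X) a)) = a"
proof -
  have i: "srt (F X) a \<in> sorts \<Sigma>"
    using assms by (rule srt_sorts)
  show ?thesis
    using free_on_extend[OF free[OF p(1)[OF i]] in_variety[OF assms(1)], of "\<lambda>_. a"] that assms p(2)[OF i]
    by (auto simp: component_iff)
qed

text \<open>The bijection from \<open>F X\<close> to \<open>F (\<Phi> X)\<close>: the element
  \<open>a\<close> is viewed as a homomorphism from \<open>F {p i}\<close>, moved by
  \<open>\<Psi>\<close>, and turned back into an element by evaluation at
  \<open>g i\<close>.\<close>

definition transport :: "'a set \<Rightarrow> 'a \<Rightarrow> 'a" where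
  "transport X a = (let i = srt (F X) a in
     \<Psi> {p i} X (THE m. m \<in> hom \<Sigma> (F {p i}) (F X) \<and> m (p i) = a) (g i))"

lemma transport_point:
  assumes X: "X \<in> C" and i: "i \<in> sorts \<Sigma>" and m: "m \<in> hom \<Sigma> (F {p i}) (F X)"
  shows "transport X (m (p i)) = \<Psi> {p i} X m (g i)"
proof -
  have "srt (F X) (m (p i)) = i"
    using hom_srt[OF m p_elem[OF i]] p(2)[OF i] by simp
  moreover have "(THE n. n \<in> hom \<Sigma> (F {p i}) (F X) \<and> n (p i) = m (p i)) = m"
    using m by (intro the_equality free_on_hom_eq[OF free[OF p(1)[OF i]]]) auto
  ultimately show ?thesis
    by (simp add: transport_def Let_def)
qed

lemma transport_component:
  assumes X: "X \<in> C" and a: "a \<in> elems (F X)"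
  shows "transport X a \<in> component (F (\<Phi> X)) (srt (F X) a)"
proof -
  let ?i = "srt (F X) a"
  have i: "?i \<in> sorts \<Sigma>"
    using X a by (rule srt_sorts)
  obtain m where m: "m \<in> hom \<Sigma> (F {p ?i}) (F X)" "m (p ?i) = a"
    using hom_point[OF X a] .
  show ?thesis
    using hom_component[OF \<Psi>_hom[OF p(1)[OF i] X m(1)], of "g ?i" ?i] transport_point[OF X i m(1)] m(2)
      g(2)[OF i] g_elem[OF i] by (simp add: component_iff)
qed

lemma transport_elems: "X \<in> C \<Longrightarrow> a \<in> elems (F X) \<Longrightarrow> transport X a \<in> elems (F (\<Phi> X))"
  and transport_srt: "X \<in> C \<Longrightarrow> a \<in> elems (F X) \<Longrightarrow> srt (F (\<Phi> X)) (transport X a) = srt (F X) a"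
  using transport_component by (auto simp: component_iff)

text \<open>If \<open>a\<close> comes from \<open>m\<close>, then \<open>\<mu> a\<close> comes from
  the composite of \<open>\<mu>\<close> and \<open>m\<close>; functoriality, evaluated at
  \<open>g i\<close>, gives the claim. So \<open>\<Psi>\<close> acts as conjugation by
  \<open>transport\<close>.\<close>

lemma transport_natural:
  assumes X: "X \<in> C" and Y: "Y \<in> C" and \<mu>: "\<mu> \<in> hom \<Sigma> (F X) (F Y)" and a: "a \<in> elems (F X)"
  shows "transport Y (\<mu> a) = \<Psi> X Y \<mu> (transport X a)"
proof -
  let ?i = "srt (F X) a"
  have i: "?i \<in> sorts \<Sigma>"
    using X a by (rule srt_sorts)
  note P = p(1)[OF i]
  obtain m where m: "m \<in> hom \<Sigma> (F {p ?i}) (F X)" "m (p ?i) = a"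
    using hom_point[OF X a] .
  have "transport Y (\<mu> a) = transport Y (compose (elems (F {p ?i})) \<mu> m (p ?i))"
    using p_elem[OF i] m(2) by (simp add: compose_eq)
  also have "\<dots> = \<Psi> {p ?i} Y (compose (elems (F {p ?i})) \<mu> m) (g ?i)"
    by (rule transport_point[OF Y i hom_compose[OF alg[OF P] m(1) \<mu>]])
  also have "\<dots> = \<Psi> X Y \<mu> (\<Psi> {p ?i} X m (g ?i))"
    using g_elem[OF i] by (simp add: \<Psi>_compose[OF P X Y m(1) \<mu>] compose_eq)
  finally show ?thesis
    using transport_point[OF X i m(1)] m(2) by simp
qed

text \<open>Faithfulness gives injectivity, because images under \<open>\<Psi>\<close> that agree at
  the free generator \<open>g i\<close> are equal. Fullness gives surjectivity, because each element
  of \<open>F (\<Phi> X)\<close> is the value at \<open>g i\<close> of some homomorphism.\<close>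

lemma transport_bij:
  assumes X: "X \<in> C"
  shows "bij_betw (transport X) (elems (F X)) (elems (F (\<Phi> X)))"
proof (rule bij_betw_imageI)
  show "inj_on (transport X) (elems (F X))"
  proof (rule inj_onI)
    fix a b
    assume a: "a \<in> elems (F X)" and b: "b \<in> elems (F X)" and eq: "transport X a = transport X b"
    let ?i = "srt (F X) a"
    have i: "?i \<in> sorts \<Sigma>"
      using X a by (rule srt_sorts)
    have ab: "srt (F X) b = ?i"
      using eq transport_srt[OF X a] transport_srt[OF X b] by simp
    obtain m where m: "m \<in> hom \<Sigma> (F {p ?i}) (F X)" "m (p ?i) = a"
      using hom_point[OF X a] .
    obtain n where n: "n \<in> hom \<Sigma> (F {p ?i}) (F X)" "n (p ?i) = b"
      using hom_point[OF X b] unfolding ab .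
    have "\<Psi> {p ?i} X m = \<Psi> {p ?i} X n"
      by (rule free_on_hom_eq[OF g(1)[OF i]])
        (use eq transport_point[OF X i m(1)] transport_point[OF X i n(1)] m n p(1)[OF i] X in
          \<open>auto intro: \<Psi>_hom\<close>)
    then have "m = n"
      by (rule \<Psi>_inj[OF p(1)[OF i] X m(1) n(1)])
    then show "a = b"
      using m n by simp
  qed
  have "b \<in> transport X ` elems (F X)" if b: "b \<in> elems (F (\<Phi> X))" for b
  proof -
    let ?i = "srt (F (\<Phi> X)) b"
    have i: "?i \<in> sorts \<Sigma>"
      using \<Phi>_ob[OF X] b by (rule srt_sorts)
    obtain h where h: "h \<in> hom \<Sigma> (F (\<Phi> {p ?i})) (F (\<Phi> X))" "h (g ?i) = b"
      using free_on_extend[OF g(1)[OF i] in_variety[OF \<Phi>_ob[OF X]], of "\<lambda>_. b"] b g(2)[OF i]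
      by (auto simp: component_iff)
    obtain m where m: "m \<in> hom \<Sigma> (F {p ?i}) (F X)" "\<Psi> {p ?i} X m = h"
      using \<Psi>_surj[OF p(1)[OF i] X h(1)] .
    then show ?thesis
      using transport_point[OF X i m(1)] h(2) hom_elems[OF m(1) p_elem[OF i]] by (metis imageI)
  qed
  then show "transport X ` elems (F X) = elems (F (\<Phi> X))"
    using transport_elems[OF X] by auto
qed

lemma transport_gens:
  assumes X: "X \<in> C"
  obtains \<sigma> \<theta> where "\<sigma> \<in> hom \<Sigma> (F X) (F (\<Phi> X))" "\<theta> \<in> hom \<Sigma> (F (\<Phi> X)) (F X)"
    "\<And>x. x \<in> X \<Longrightarrow> \<theta> (transport X x) = x"
    "\<And>a. a \<in> elems (F X) \<Longrightarrow> \<theta> (\<sigma> a) = a" "\<And>b. b \<in> elems (F (\<Phi> X)) \<Longrightarrow> \<sigma> (\<theta> b) = b"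
proof -
  note X' = \<Phi>_ob[OF X]
  note el = gens_elems[OF X]
  obtain \<sigma> where \<sigma>: "\<sigma> \<in> hom \<Sigma> (F X) (F (\<Phi> X))" "\<And>x. x \<in> X \<Longrightarrow> \<sigma> x = transport X x"
    using free_on_extend[OF free[OF X] in_variety[OF X'], of "transport X"] transport_component[OF X el] by blast
  \<comment> \<open>\<open>F X\<close> itself is \<open>F (\<Phi> Y)\<close> for some
    \<open>Y\<close>. A homomorphism \<open>\<beta>\<close> to \<open>F Y\<close> that picks
    preimages of the generators under \<open>transport Y\<close> is mapped by the functor to the
    required \<open>\<theta>\<close>.\<close>
  obtain Y where Y: "Y \<in> C" "\<Phi> Y = X"
    using \<Phi>_surj[OF X] by blast
  have "\<exists>y\<in>component (F Y) (srt (F X) x). transport Y y = x" if x: "x \<in> X" for x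
  proof -
    obtain y where "y \<in> elems (F Y)" "x = transport Y y"
      using bij_betw_imp_surj_on[OF transport_bij[OF Y(1)]] el[OF x] unfolding Y(2) by blast
    then show ?thesis
      using transport_srt[OF Y(1), of y] by (auto simp: Y(2) component_iff)
  qed
  then obtain y where y: "\<And>x. x \<in> X \<Longrightarrow> y x \<in> component (F Y) (srt (F X) x)"
      "\<And>x. x \<in> X \<Longrightarrow> transport Y (y x) = x"
    by metis
  obtain \<beta> where \<beta>: "\<beta> \<in> hom \<Sigma> (F X) (F Y)" "\<And>x. x \<in> X \<Longrightarrow> \<beta> x = y x"
    using free_on_extend[OF free[OF X] in_variety[OF Y(1)], of y] y(1) by blast
  define \<theta> where "\<theta> = \<Psi> X Y \<beta>"
  have \<theta>: "\<theta> \<in> hom \<Sigma> (F (\<Phi> X)) (F X)"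
    using \<Psi>_hom[OF X Y(1) \<beta>(1)] by (simp add: \<theta>_def Y(2))
  have \<theta>X: "\<theta> (transport X x) = x" if "x \<in> X" for x
    using transport_natural[OF X Y(1) \<beta>(1) el[OF that]] \<beta>(2)[OF that] y(2)[OF that] by (simp add: \<theta>_def)
  have "compose (elems (F X)) \<theta> \<sigma> = (\<lambda>a\<in>elems (F X). a)"
    by (rule free_on_hom_eq[OF free[OF X] hom_compose[OF alg[OF X] \<sigma>(1) \<theta>] hom_id[OF alg[OF X]]])
      (simp add: compose_eq el \<sigma>(2) \<theta>X)
  then have \<theta>\<sigma>: "\<theta> (\<sigma> a) = a" if "a \<in> elems (F X)" for a
    using that by (metis compose_eq restrict_apply')
  \<comment> \<open>By fullness the other composite is the image of some \<open>\<gamma>\<close>.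
    Naturality and injectivity of \<open>transport X\<close> show that \<open>\<gamma>\<close> fixes
    \<open>X\<close>, so \<open>\<gamma>\<close> and its image are identities.\<close>
  obtain \<gamma> where \<gamma>: "\<gamma> \<in> hom \<Sigma> (F X) (F X)" "\<Psi> X X \<gamma> = compose (elems (F (\<Phi> X))) \<sigma> \<theta>"
    using \<Psi>_surj[OF X X hom_compose[OF alg[OF X'] \<theta> \<sigma>(1)]] .
  have "\<gamma> x = x" if x: "x \<in> X" for x
  proof -
    have "transport X (\<gamma> x) = transport X x"
      using transport_natural[OF X X \<gamma>(1) el[OF x]] transport_elems[OF X el[OF x]] \<theta>X[OF x] \<sigma>(2)[OF x]
      by (simp add: \<gamma>(2) compose_eq)
    then show ?thesis
      using transport_bij[OF X] hom_elems[OF \<gamma>(1) el[OF x]] el[OF x] by (auto simp: bij_betw_def dest: inj_onD)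
  qed
  then have "\<gamma> = (\<lambda>a\<in>elems (F X). a)"
    using free_on_hom_eq[OF free[OF X] \<gamma>(1) hom_id[OF alg[OF X]]] el by simp
  then have "\<sigma> (\<theta> b) = b" if "b \<in> elems (F (\<Phi> X))" for b
    using that \<gamma>(2) \<Psi>_id[OF X] by (metis compose_eq restrict_apply')
  with \<sigma>(1) \<theta> \<theta>X \<theta>\<sigma> show ?thesis
    using that by blast
qed

section \<open>Closed sets and words obtained from an automorphism\<close>

text \<open>The condition on natural epimorphisms, applied to homomorphisms from
  \<open>F {p i}\<close>, determines the sets \<open>\<alpha> Y T\<close> pair by pair: each is the
  image of \<open>T\<close> under \<open>transport Y\<close>.\<close>

lemma Cl_transport:
  assumes \<alpha>: "\<And>X. X \<in> C \<Longrightarrow> bij_betw (\<alpha> X) (Cl \<Sigma> H\<^sub>1 (F X)) (Cl \<Sigma> H\<^sub>2 (F (\<Phi> X)))"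
    and iff: "\<And>X Y \<mu>\<^sub>1 \<mu>\<^sub>2 T. X \<in> C \<Longrightarrow> Y \<in> C \<Longrightarrow> \<mu>\<^sub>1 \<in> hom \<Sigma> (F X) (F Y) \<Longrightarrow>
      \<mu>\<^sub>2 \<in> hom \<Sigma> (F X) (F Y) \<Longrightarrow> T \<in> Cl \<Sigma> H\<^sub>1 (F Y) \<Longrightarrow>
        compose (elems (F X)) (nat_epi (F Y) T) \<mu>\<^sub>1 = compose (elems (F X)) (nat_epi (F Y) T) \<mu>\<^sub>2 \<longleftrightarrow>
        compose (elems (F (\<Phi> X))) (nat_epi (F (\<Phi> Y)) (\<alpha> Y T)) (\<Psi> X Y \<mu>\<^sub>1) =
        compose (elems (F (\<Phi> X))) (nat_epi (F (\<Phi> Y)) (\<alpha> Y T)) (\<Psi> X Y \<mu>\<^sub>2)"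
    and Y: "Y \<in> C" and T: "T \<subseteq> sorted_pairs (F Y)"
  shows "T \<in> Cl \<Sigma> H\<^sub>1 (F Y) \<longleftrightarrow> map_prod (transport Y) (transport Y) ` T \<in> Cl \<Sigma> H\<^sub>2 (F (\<Phi> Y))"
proof -
  let ?s = "transport Y"
  have mem: "(a, b) \<in> T \<longleftrightarrow> (?s a, ?s b) \<in> \<alpha> Y T"
    if T: "T \<in> Cl \<Sigma> H\<^sub>1 (F Y)" and ab: "(a, b) \<in> sorted_pairs (F Y)" for T a b
  proof -
    let ?i = "srt (F Y) a"
    have a: "a \<in> elems (F Y)" and b: "b \<in> elems (F Y)" and ba: "srt (F Y) b = ?i"
      using ab by (auto simp: sorted_pairs_iff)
    have i: "?i \<in> sorts \<Sigma>"
      using Y a by (rule srt_sorts)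
    note P = p(1)[OF i]
    obtain m where m: "m \<in> hom \<Sigma> (F {p ?i}) (F Y)" "m (p ?i) = a"
      using hom_point[OF Y a] .
    obtain n where n: "n \<in> hom \<Sigma> (F {p ?i}) (F Y)" "n (p ?i) = b"
      using hom_point[OF Y b] unfolding ba .
    have \<alpha>T: "\<alpha> Y T \<in> Cl \<Sigma> H\<^sub>2 (F (\<Phi> Y))"
      using \<alpha>[OF Y] T by (auto simp: bij_betw_def)
    \<comment> \<open>Equality of the composites is tested at the single free generators
      \<open>p i\<close> and \<open>g i\<close>, where the homomorphisms take the values
      \<open>a\<close>, \<open>b\<close> and \<open>?s a\<close>, \<open>?s b\<close>.\<close>
    show ?thesis
      using iff[OF P Y m(1) n(1) T] m(2) n(2) transport_point[OF Y i m(1)] transport_point[OF Y i n(1)]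
      unfolding compose_nat_epi_eq_iff[OF T free[OF P] m(1) n(1)]
        compose_nat_epi_eq_iff[OF \<alpha>T g(1)[OF i] \<Psi>_hom[OF P Y m(1)] \<Psi>_hom[OF P Y n(1)]]
      by simp
  qed
  have img: "\<alpha> Y T = map_prod ?s ?s ` T" if T: "T \<in> Cl \<Sigma> H\<^sub>1 (F Y)" for T
  proof (intro subset_antisym subsetI)
    have sub: "\<alpha> Y T \<subseteq> sorted_pairs (F (\<Phi> Y))"
      using T \<alpha>[OF Y] by (auto simp: Cl_def bij_betw_def)
    fix q assume q: "q \<in> \<alpha> Y T"
    then obtain c d where cd: "q = (c, d)" "c \<in> elems (F (\<Phi> Y))" "d \<in> elems (F (\<Phi> Y))"
      "srt (F (\<Phi> Y)) c = srt (F (\<Phi> Y)) d"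
      using sub by (cases q) (auto simp: sorted_pairs_iff)
    then obtain a b where "c = ?s a" "d = ?s b" "a \<in> elems (F Y)" "b \<in> elems (F Y)"
      using transport_bij[OF Y] unfolding bij_betw_def by (metis imageE)
    moreover from this have "(a, b) \<in> T"
      using mem[OF T, of a b] q cd transport_srt[OF Y] by (auto simp: sorted_pairs_iff)
    ultimately show "q \<in> map_prod ?s ?s ` T"
      using cd(1) by force
  next
    have sub: "T \<subseteq> sorted_pairs (F Y)"
      using T by (auto simp: Cl_def)
    fix q assume "q \<in> map_prod ?s ?s ` T"
    then show "q \<in> \<alpha> Y T"
      using mem[OF T] sub by auto
  qed
  have inj: "inj_on (map_prod ?s ?s) (sorted_pairs (F Y))"
    using transport_bij[OF Y] by (auto simp: inj_on_def bij_betw_def sorted_pairs_iff)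
  \<comment> \<open>Surjectivity of \<open>\<alpha> Y\<close> writes the image of \<open>T\<close>
    as the image of a closed set \<open>S\<close>, and injectivity yields
    \<open>S = T\<close>.\<close>
  have "T \<in> Cl \<Sigma> H\<^sub>1 (F Y)" if "map_prod ?s ?s ` T \<in> Cl \<Sigma> H\<^sub>2 (F (\<Phi> Y))"
  proof -
    have "map_prod ?s ?s ` T \<in> \<alpha> Y ` Cl \<Sigma> H\<^sub>1 (F Y)"
      using that by (simp only: bij_betw_imp_surj_on[OF \<alpha>[OF Y]])
    then obtain S where S: "S \<in> Cl \<Sigma> H\<^sub>1 (F Y)" "\<alpha> Y S = map_prod ?s ?s ` T"
      by (metis imageE)
    then have "S = T"
      using img[OF S(1)] inj_on_image_eq_iff[OF inj _ T, of S] by (simp add: Cl_def)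
    with S show ?thesis by simp
  qed
  then show ?thesis
    using img[of T] bij_betwE[OF \<alpha>[OF Y]] by auto
qed

text \<open>Following \<open>transport X\<close> by the isomorphism back to \<open>F X\<close> gives
  a bijection of \<open>F X\<close> that fixes \<open>X\<close>, as needed to obtain words. The
  isomorphism respects closedness over every \<open>H\<close>, which gives the last clause.\<close>

lemma verbal_words:
  obtains W t where "Op1 \<Sigma> F xs W"
    "\<And>X. X \<in> C \<Longrightarrow> t X \<in> iso \<Sigma> (F X) (verbal_alg \<Sigma> F xs W (F X))"
    "\<And>X x. X \<in> C \<Longrightarrow> x \<in> X \<Longrightarrow> t X x = x"
    "\<And>H X T. X \<in> C \<Longrightarrow> T \<subseteq> sorted_pairs (F X) \<Longrightarrow>
      map_prod (t X) (t X) ` T \<in> Cl \<Sigma> H (F X) \<longleftrightarrow>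
      map_prod (transport X) (transport X) ` T \<in> Cl \<Sigma> (H :: ('s, 'o, 'a) alg) (F (\<Phi> X))"
proof -
  \<comment> \<open>Bundling the properties lets one use of choice produce \<open>\<sigma>\<close>
    and \<open>\<theta>\<close> as functions of \<open>X\<close>.\<close>
  define Q where "Q X \<sigma> \<theta> \<longleftrightarrow> \<sigma> \<in> hom \<Sigma> (F X) (F (\<Phi> X)) \<and> \<theta> \<in> hom \<Sigma> (F (\<Phi> X)) (F X) \<and>
    (\<forall>x\<in>X. \<theta> (transport X x) = x) \<and>
    (\<forall>a\<in>elems (F X). \<theta> (\<sigma> a) = a) \<and> (\<forall>b\<in>elems (F (\<Phi> X)). \<sigma> (\<theta> b) = b)" for X \<sigma> \<theta>
  have "\<exists>\<sigma> \<theta>. Q X \<sigma> \<theta>" if X: "X \<in> C" for X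
  proof -
    obtain \<sigma> \<theta> where "\<sigma> \<in> hom \<Sigma> (F X) (F (\<Phi> X))" "\<theta> \<in> hom \<Sigma> (F (\<Phi> X)) (F X)"
      "\<And>x. x \<in> X \<Longrightarrow> \<theta> (transport X x) = x"
      "\<And>a. a \<in> elems (F X) \<Longrightarrow> \<theta> (\<sigma> a) = a" "\<And>b. b \<in> elems (F (\<Phi> X)) \<Longrightarrow> \<sigma> (\<theta> b) = b"
      by (rule transport_gens[OF X]) blast
    then have "Q X \<sigma> \<theta>"
      by (simp add: Q_def)
    then show ?thesis by blast
  qed
  then obtain \<sigma> \<theta> where Q: "\<And>X. X \<in> C \<Longrightarrow> Q X (\<sigma> X) (\<theta> X)"
    by metis
  have \<sigma>: "\<And>X. X \<in> C \<Longrightarrow> \<sigma> X \<in> hom \<Sigma> (F X) (F (\<Phi> X))"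
    and \<theta>: "\<And>X. X \<in> C \<Longrightarrow> \<theta> X \<in> hom \<Sigma> (F (\<Phi> X)) (F X)"
    and \<theta>X: "\<And>X x. X \<in> C \<Longrightarrow> x \<in> X \<Longrightarrow> \<theta> X (transport X x) = x"
    and \<theta>\<sigma>: "\<And>X a. X \<in> C \<Longrightarrow> a \<in> elems (F X) \<Longrightarrow> \<theta> X (\<sigma> X a) = a"
    and \<sigma>\<theta>: "\<And>X b. X \<in> C \<Longrightarrow> b \<in> elems (F (\<Phi> X)) \<Longrightarrow> \<sigma> X (\<theta> X b) = b"
    using Q unfolding Q_def by blast+
  define t where "t X = compose (elems (F X)) (\<theta> X) (transport X)" for X
  have t: "t X a = \<theta> X (transport X a)" if "a \<in> elems (F X)" for X a
    using that by (simp add: t_def compose_eq)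
  have \<sigma>t: "\<sigma> X (t X a) = transport X a" if "X \<in> C" "a \<in> elems (F X)" for X a
    using that by (simp add: t \<sigma>\<theta> transport_elems)
  have \<theta>_bij: "bij_betw (\<theta> X) (elems (F (\<Phi> X))) (elems (F X))" if "X \<in> C" for X
    by (rule bij_betw_byWitness[where f' = "\<sigma> X"])
      (use that \<sigma>\<theta> \<theta>\<sigma> hom_elems[OF \<theta>] hom_elems[OF \<sigma>] in auto)
  have t_bij: "bij_betw (t X) (elems (F X)) (elems (F X))" if "X \<in> C" for X
    using bij_betw_trans[OF transport_bij[OF that] \<theta>_bij[OF that]]
    by (rule bij_betw_cong[THEN iffD1, rotated]) (simp add: t)
  have tX: "t X x = x" if "X \<in> C" "x \<in> X" for X x
    using that by (simp add: t gens_elems \<theta>X)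
  obtain W where W: "Op1 \<Sigma> F xs W" "\<And>X. X \<in> C \<Longrightarrow> t X \<in> iso \<Sigma> (F X) (verbal_alg \<Sigma> F xs W (F X))"
  proof (rule words_of_natural_bijections[of t])
    show "t X \<in> extensional (elems (F X))" for X
      by (simp add: t_def compose_def)
    show "srt (F X) (t X a) = srt (F X) a" if "X \<in> C" "a \<in> elems (F X)" for X a
      using that hom_srt[OF \<theta>] by (simp add: t transport_elems transport_srt)
    show "\<exists>\<nu>\<in>hom \<Sigma> (F X) (F Y). \<forall>a\<in>elems (F X). t Y (\<mu> a) = \<nu> (t X a)"
      if X: "X \<in> C" and Y: "Y \<in> C" and \<mu>: "\<mu> \<in> hom \<Sigma> (F X) (F Y)" for X Y \<mu>
    proof
      \<comment> \<open>Since \<open>\<sigma> X\<close> turns \<open>t X\<close> back into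
        \<open>transport X\<close>, naturality dictates this witness:
        \<open>\<Psi> X Y \<mu>\<close> between \<open>\<sigma> X\<close> and
        \<open>\<theta> Y\<close>.\<close>
      show "compose (elems (F X)) (\<theta> Y) (compose (elems (F X)) (\<Psi> X Y \<mu>) (\<sigma> X)) \<in> hom \<Sigma> (F X) (F Y)"
        by (rule hom_compose[OF alg[OF X] hom_compose[OF alg[OF X] \<sigma>[OF X] \<Psi>_hom[OF X Y \<mu>]] \<theta>[OF Y]])
      show "\<forall>a\<in>elems (F X). t Y (\<mu> a) =
          compose (elems (F X)) (\<theta> Y) (compose (elems (F X)) (\<Psi> X Y \<mu>) (\<sigma> X)) (t X a)"
      proof
        fix a assume a: "a \<in> elems (F X)"
        then have "t X a \<in> elems (F X)"
          using t_bij[OF X] by (auto simp: bij_betw_def)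
        with a X Y \<mu> show "t Y (\<mu> a) =
            compose (elems (F X)) (\<theta> Y) (compose (elems (F X)) (\<Psi> X Y \<mu>) (\<sigma> X)) (t X a)"
          by (simp add: compose_eq \<sigma>t t[of "\<mu> a"] hom_elems[OF \<mu>] transport_natural)
      qed
    qed
  qed (use t_bij tX in auto)
  have Cl_t: "map_prod (t X) (t X) ` T \<in> Cl \<Sigma> H (F X) \<longleftrightarrow>
      map_prod (transport X) (transport X) ` T \<in> Cl \<Sigma> H (F (\<Phi> X))"
    if X: "X \<in> C" and T: "T \<subseteq> sorted_pairs (F X)" for X T and H :: "('s, 'o, 'a) alg"
  proof -
    let ?S = "map_prod (transport X) (transport X) ` T"
    \<comment> \<open>Precomposition with \<open>\<theta> X\<close> reaches every
      \<open>\<psi>\<close> because \<open>\<sigma> X\<close> inverts it. So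
      \<open>Cl_transfer\<close> applies to \<open>\<theta> X\<close> with \<open>H\<close> on both
      sides.\<close>
    have "\<psi> \<in> (\<lambda>\<phi>. compose (elems (F (\<Phi> X))) \<phi> (\<theta> X)) ` hom \<Sigma> (F X) H"
      if \<psi>: "\<psi> \<in> hom \<Sigma> (F (\<Phi> X)) H" for \<psi>
    proof
      show *: "compose (elems (F X)) \<psi> (\<sigma> X) \<in> hom \<Sigma> (F X) H"
        by (rule hom_compose[OF alg[OF X] \<sigma>[OF X] \<psi>])
      show "\<psi> = compose (elems (F (\<Phi> X))) (compose (elems (F X)) \<psi> (\<sigma> X)) (\<theta> X)"
        by (rule hom_eqI[OF \<psi> hom_compose[OF alg[OF \<Phi>_ob[OF X]] \<theta>[OF X] *]])
          (simp add: compose_eq hom_elems[OF \<theta>[OF X]] \<sigma>\<theta>[OF X])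
    qed
    then have homs: "hom \<Sigma> (F (\<Phi> X)) H = (\<lambda>\<phi>. compose (elems (F (\<Phi> X))) \<phi> (\<theta> X)) ` hom \<Sigma> (F X) H"
      using hom_compose[OF alg[OF \<Phi>_ob[OF X]] \<theta>[OF X]] by blast
    have "?S \<subseteq> sorted_pairs (F (\<Phi> X))"
      using T transport_elems[OF X] transport_srt[OF X] by (force simp: sorted_pairs_iff)
    from Cl_transfer[OF \<theta>_bij[OF X] hom_srt[OF \<theta>[OF X]] homs this]
    have "?S \<in> Cl \<Sigma> H (F (\<Phi> X)) \<longleftrightarrow> map_prod (\<theta> X) (\<theta> X) ` ?S \<in> Cl \<Sigma> H (F X)" .
    moreover have "map_prod (\<theta> X) (\<theta> X) ` ?S = map_prod (t X) (t X) ` T"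
      unfolding image_image by (rule image_cong) (use T in \<open>auto simp: sorted_pairs_iff t subset_iff\<close>)
    ultimately show ?thesis by simp
  qed
  show ?thesis
    by (rule that[of W t]) (fact W tX Cl_t)+
qed

end

section \<open>Automorphic equivalence obtained from a system of words\<close>

context free_category
begin

text \<open>Conjugation by the isomorphisms \<open>s X\<close> of \<open>Op2\<close> is an
  automorphism that is the identity on objects. Taking images under \<open>s X\<close> moves closed
  sets over \<open>H\<^sub>1\<close> bijectively to closed sets over \<open>H\<^sub>2\<close>, by
  geometric equivalence.\<close>

lemma auto_equiv_of_words:
  assumes H\<^sub>2: "H\<^sub>2 \<in> variety \<Sigma> E" and W: "Op1 \<Sigma> F xs W" "Op2 \<Sigma> F C xs W"
    and geom: "geom_equiv \<Sigma> F C H\<^sub>1 (verbal_alg \<Sigma> F xs W H\<^sub>2)"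
  shows "auto_equiv \<Sigma> F C H\<^sub>1 H\<^sub>2"
proof -
  obtain s where s: "\<And>X. X \<in> C \<Longrightarrow> s X \<in> iso \<Sigma> (F X) (verbal_alg \<Sigma> F xs W (F X))"
    and sX: "\<And>X x. X \<in> C \<Longrightarrow> x \<in> X \<Longrightarrow> s X x = x"
    using W(2) unfolding Op2_def by metis
  have s_hom: "s X \<in> hom \<Sigma> (F X) (verbal_alg \<Sigma> F xs W (F X))"
    and s_bij: "bij_betw (s X) (elems (F X)) (elems (F X))" if "X \<in> C" for X
    using s[OF that] by (auto simp: iso_def)
  have s_el: "s X a \<in> elems (F X)" and s_srt: "srt (F X) (s X a) = srt (F X) a"
    if "X \<in> C" "a \<in> elems (F X)" for X a
    using hom_elems[OF s_hom] hom_srt[OF s_hom] that by force+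
  define r where "r X = inv_into (elems (F X)) (s X)" for X
  have rs: "r X (s X a) = a" if "X \<in> C" "a \<in> elems (F X)" for X a
    using s_bij[OF that(1)] that(2) by (simp add: r_def bij_betw_inv_into_left)
  have sr: "s X (r X a) = a" and r_el: "r X a \<in> elems (F X)" if "X \<in> C" "a \<in> elems (F X)" for X a
    using s_bij[OF that(1)] that(2) by (auto simp: r_def bij_betw_inv_into_right bij_betw_def inv_into_into)
  have r_srt: "srt (F X) (r X a) = srt (F X) a" if "X \<in> C" "a \<in> elems (F X)" for X a
    using s_srt[OF that(1) r_el[OF that]] sr[OF that] by simp
  define \<Psi> where "\<Psi> X Y \<mu> = (\<lambda>b\<in>elems (F X). s Y (\<mu> (r X b)))" for X Y and \<mu> :: "'a \<Rightarrow> 'a"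
  \<comment> \<open>By \<open>verbal_hom\<close>, \<open>\<nu>\<close> is also a homomorphism
    between the algebras of verbal operations. Hence both composites go from \<open>F X\<close> to
    the verbal algebra of \<open>F Y\<close>, and they agree on \<open>X\<close> because
    \<open>s X\<close> fixes it.\<close>
  have conj: "\<nu> (s X a) = s Y (\<mu> a)"
    if X: "X \<in> C" and Y: "Y \<in> C" and \<mu>: "\<mu> \<in> hom \<Sigma> (F X) (F Y)" and \<nu>: "\<nu> \<in> hom \<Sigma> (F X) (F Y)"
      and eq: "\<And>x. x \<in> X \<Longrightarrow> \<nu> x = s Y (\<mu> x)" and a: "a \<in> elems (F X)" for X Y \<mu> \<nu> a
  proof -
    have "compose (elems (F X)) \<nu> (s X) = compose (elems (F X)) (s Y) \<mu>"
      by (rule free_on_hom_eq[OF free[OF X]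
            hom_compose[OF alg[OF X] s_hom[OF X] verbal_hom[OF W(1) in_variety[OF X] \<nu>]]
            hom_compose[OF alg[OF X] \<mu> s_hom[OF Y]]])
        (simp add: compose_eq gens_elems[OF X] sX[OF X] eq)
    then show ?thesis
      using a by (metis compose_eq)
  qed
  have \<Psi>_eq: "\<Psi> X Y \<mu> = \<nu>"
    if X: "X \<in> C" and Y: "Y \<in> C" and \<mu>: "\<mu> \<in> hom \<Sigma> (F X) (F Y)" and \<nu>: "\<nu> \<in> hom \<Sigma> (F X) (F Y)"
      and eq: "\<And>x. x \<in> X \<Longrightarrow> \<nu> x = s Y (\<mu> x)" for X Y \<mu> \<nu>
  proof
    fix b
    show "\<Psi> X Y \<mu> b = \<nu> b"
    proof (cases "b \<in> elems (F X)")
      case True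
      then show ?thesis
        using conj[OF X Y \<mu> \<nu> eq r_el[OF X True]] sr[OF X True] by (simp add: \<Psi>_def)
    next
      case False
      then show ?thesis
        using \<nu> by (auto simp: \<Psi>_def hom_def PiE_def extensional_def)
    qed
  qed
  \<comment> \<open>A conjugate of \<open>\<mu>\<close> is at first a homomorphism of algebras of
    verbal operations. It is one of the original algebras because it equals the homomorphism given
    by freeness with values \<open>s Y (\<mu> x)\<close> on \<open>X\<close>.\<close>
  have \<Psi>_hom: "\<Psi> X Y \<mu> \<in> hom \<Sigma> (F X) (F Y)"
    if X: "X \<in> C" and Y: "Y \<in> C" and \<mu>: "\<mu> \<in> hom \<Sigma> (F X) (F Y)" for X Y \<mu>
  proof -
    have "s Y (\<mu> x) \<in> component (F Y) (srt (F X) x)" if "x \<in> X" for x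
      using gens_elems[OF X that] hom_elems[OF \<mu>] hom_srt[OF \<mu>] s_el[OF Y] s_srt[OF Y] by (simp add: component_iff)
    then obtain \<nu> where \<nu>: "\<nu> \<in> hom \<Sigma> (F X) (F Y)" "\<And>x. x \<in> X \<Longrightarrow> \<nu> x = s Y (\<mu> x)"
      using free_on_extend[OF free[OF X] in_variety[OF Y], of "\<lambda>x. s Y (\<mu> x)"] by blast
    then show ?thesis
      using \<Psi>_eq[OF X Y \<mu> \<nu>] by simp
  qed
  have \<Psi>_bij: "bij_betw (\<Psi> X Y) (hom \<Sigma> (F X) (F Y)) (hom \<Sigma> (F X) (F Y))"
    if X: "X \<in> C" and Y: "Y \<in> C" for X Y
  proof (rule bij_betw_imageI)
    show "inj_on (\<Psi> X Y) (hom \<Sigma> (F X) (F Y))"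
    proof (intro inj_onI hom_eqI)
      fix \<mu> \<nu> a
      assume \<mu>: "\<mu> \<in> hom \<Sigma> (F X) (F Y)" and \<nu>: "\<nu> \<in> hom \<Sigma> (F X) (F Y)"
        and eq: "\<Psi> X Y \<mu> = \<Psi> X Y \<nu>" and a: "a \<in> elems (F X)"
      have "s Y (\<mu> a) = s Y (\<nu> a)"
        using fun_cong[OF eq, of "s X a"] s_el[OF X a] rs[OF X a] by (simp add: \<Psi>_def)
      then show "\<mu> a = \<nu> a"
        using rs[OF Y] hom_elems[OF \<mu> a] hom_elems[OF \<nu> a] by metis
    qed
    have "\<nu> \<in> \<Psi> X Y ` hom \<Sigma> (F X) (F Y)" if \<nu>: "\<nu> \<in> hom \<Sigma> (F X) (F Y)" for \<nu>
    proof -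
      have el: "x \<in> elems (F X)" "\<nu> x \<in> elems (F Y)" if "x \<in> X" for x
        using gens_elems[OF X that] hom_elems[OF \<nu>] by auto
      have "r Y (\<nu> x) \<in> component (F Y) (srt (F X) x)" if "x \<in> X" for x
        using el[OF that] hom_srt[OF \<nu>] r_el[OF Y] r_srt[OF Y] by (simp add: component_iff)
      \<comment> \<open>The preimage of \<open>\<nu>\<close> is prescribed on generators by undoing
        \<open>s Y\<close> there.\<close>
      then obtain \<mu> where \<mu>: "\<mu> \<in> hom \<Sigma> (F X) (F Y)" "\<And>x. x \<in> X \<Longrightarrow> \<mu> x = r Y (\<nu> x)"
        using free_on_extend[OF free[OF X] in_variety[OF Y], of "\<lambda>x. r Y (\<nu> x)"] by blast
      have "\<Psi> X Y \<mu> = \<nu>"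
        by (rule \<Psi>_eq[OF X Y \<mu>(1) \<nu>]) (simp add: \<mu>(2) sr[OF Y] el)
      with \<mu>(1) show ?thesis by blast
    qed
    then show "\<Psi> X Y ` hom \<Sigma> (F X) (F Y) = hom \<Sigma> (F X) (F Y)"
      using \<Psi>_hom[OF X Y] by blast
  qed
  have \<Psi>_compose: "\<Psi> X Z (compose (elems (F X)) \<nu> \<mu>) = compose (elems (F X)) (\<Psi> Y Z \<nu>) (\<Psi> X Y \<mu>)"
    if "X \<in> C" "Y \<in> C" "\<mu> \<in> hom \<Sigma> (F X) (F Y)" for X Y Z \<mu> \<nu>
    using that by (auto simp: \<Psi>_def compose_def fun_eq_iff r_el s_el rs hom_elems[OF that(3)])
  have "cat_automorphism \<Sigma> F C (\<lambda>X. X) \<Psi>"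
    unfolding cat_automorphism_def endofunctor_def
    using \<Psi>_hom \<Psi>_bij \<Psi>_compose by (auto simp: bij_betw_def \<Psi>_def r_el sr cong: restrict_cong)
  define \<alpha> where "\<alpha> X T = map_prod (s X) (s X) ` T" for X T
  \<comment> \<open>Geometric equivalence replaces \<open>H\<^sub>1\<close> by the verbal algebra of
    \<open>H\<^sub>2\<close>; passing along \<open>s X\<close> then leads to
    \<open>H\<^sub>2\<close> itself.\<close>
  have Cl_iff: "T \<in> Cl \<Sigma> H\<^sub>1 (F X) \<longleftrightarrow> T \<subseteq> sorted_pairs (F X) \<and> \<alpha> X T \<in> Cl \<Sigma> H\<^sub>2 (F X)" if X: "X \<in> C" for X T
    using Cl_verbal_alg[OF W(1) X H\<^sub>2 s[OF X] sX[OF X], of T] geom X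
    unfolding geom_equiv_iff_Cl \<alpha>_def by (auto simp: Cl_def)
  have inj: "inj_on (map_prod (s X) (s X)) (sorted_pairs (F X))" if X: "X \<in> C" for X
    using s_bij[OF X] by (auto simp: inj_on_def bij_betw_def sorted_pairs_iff)
  have \<alpha>_bij: "bij_betw (\<alpha> X) (Cl \<Sigma> H\<^sub>1 (F X)) (Cl \<Sigma> H\<^sub>2 (F X))" if X: "X \<in> C" for X
  proof (rule bij_betw_imageI)
    show "inj_on (\<alpha> X) (Cl \<Sigma> H\<^sub>1 (F X))"
      using inj_on_image_eq_iff[OF inj[OF X]] by (auto simp: inj_on_def \<alpha>_def Cl_def)
    have "S \<in> \<alpha> X ` Cl \<Sigma> H\<^sub>1 (F X)" if S: "S \<in> Cl \<Sigma> H\<^sub>2 (F X)" for S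
    proof -
      have sub: "S \<subseteq> sorted_pairs (F X)"
        using S by (simp add: Cl_def)
      have "\<alpha> X (map_prod (r X) (r X) ` S) = (\<lambda>q. q) ` S"
        unfolding \<alpha>_def image_image by (rule image_cong) (use sub sr[OF X] in \<open>auto simp: sorted_pairs_iff\<close>)
      moreover have "map_prod (r X) (r X) ` S \<subseteq> sorted_pairs (F X)"
        using sub r_el[OF X] r_srt[OF X] by (force simp: sorted_pairs_iff)
      ultimately show ?thesis
        using Cl_iff[OF X, of "map_prod (r X) (r X) ` S"] S by (intro image_eqI) auto
    qed
    then show "\<alpha> X ` Cl \<Sigma> H\<^sub>1 (F X) = Cl \<Sigma> H\<^sub>2 (F X)"
      using Cl_iff[OF X] by blast
  qed
  have \<alpha>_mem: "(s Y a, s Y b) \<in> \<alpha> Y T \<longleftrightarrow> (a, b) \<in> T"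
    if Y: "Y \<in> C" and T: "T \<subseteq> sorted_pairs (F Y)" and "(a, b) \<in> sorted_pairs (F Y)" for Y T a b
    using inj_on_image_mem_iff[OF inj[OF Y] that(3) T] by (simp add: \<alpha>_def)
  have "compose (elems (F X)) (nat_epi (F Y) T) \<mu>\<^sub>1 = compose (elems (F X)) (nat_epi (F Y) T) \<mu>\<^sub>2 \<longleftrightarrow>
      compose (elems (F X)) (nat_epi (F Y) (\<alpha> Y T)) (\<Psi> X Y \<mu>\<^sub>1) =
      compose (elems (F X)) (nat_epi (F Y) (\<alpha> Y T)) (\<Psi> X Y \<mu>\<^sub>2)"
    if X: "X \<in> C" and Y: "Y \<in> C" and \<mu>: "\<mu>\<^sub>1 \<in> hom \<Sigma> (F X) (F Y)" "\<mu>\<^sub>2 \<in> hom \<Sigma> (F X) (F Y)"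
      and T: "T \<in> Cl \<Sigma> H\<^sub>1 (F Y)" for X Y \<mu>\<^sub>1 \<mu>\<^sub>2 T
  proof -
    have \<alpha>T: "\<alpha> Y T \<in> Cl \<Sigma> H\<^sub>2 (F Y)" and sub: "T \<subseteq> sorted_pairs (F Y)"
      using Cl_iff[OF Y] T by auto
    have \<Psi>x: "\<Psi> X Y \<mu> x = s Y (\<mu> x)" if "x \<in> X" for x and \<mu> :: "'a \<Rightarrow> 'a"
      using gens_elems[OF X that] rs[OF X, of x] sX[OF X that] by (simp add: \<Psi>_def)
    have "(\<mu>\<^sub>1 x, \<mu>\<^sub>2 x) \<in> sorted_pairs (F Y)" if "x \<in> X" for x
      using gens_elems[OF X that] \<mu> by (simp add: sorted_pairs_iff hom_elems hom_srt)
    then show ?thesis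
      unfolding compose_nat_epi_eq_iff[OF T free[OF X] \<mu>]
        compose_nat_epi_eq_iff[OF \<alpha>T free[OF X] \<Psi>_hom[OF X Y \<mu>(1)] \<Psi>_hom[OF X Y \<mu>(2)]]
      using \<alpha>_mem[OF Y sub] \<Psi>x by auto
  qed
  with \<open>cat_automorphism \<Sigma> F C (\<lambda>X. X) \<Psi>\<close> \<alpha>_bij show ?thesis
    unfolding auto_equiv_def by (intro exI[of _ "\<lambda>X. X"] exI[of _ \<Psi>] exI[of _ \<alpha>]) blast
qed

end

section \<open>Automorphic equivalence characterised by verbal operations\<close>

theorem theorem4p3:
  fixes \<Sigma> :: "('s, 'o) signature"
    and E :: "(('o, 's \<times> 'v) trm \<times> ('o, 's \<times> 'v) trm) set"
    and \<Theta> :: "('s, 'o, 'a) alg set"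
    and X\<^sub>0 :: "'a set" and \<eta>\<^sub>0 :: "'a \<Rightarrow> 's"
    and F :: "'a set \<Rightarrow> ('s, 'o, 'a) alg"
    and C :: "'a set set"
    and xs :: "'o \<Rightarrow> 'a list"
    and H\<^sub>1 H\<^sub>2 :: "('s, 'o, 'a) alg"
  assumes "wf_signature \<Sigma>"
    and "\<forall>e\<in>E. is_identity \<Sigma> e"
    and "\<Theta> = variety \<Sigma> E"
    and "sorted_alphabet \<Sigma> X\<^sub>0 \<eta>\<^sub>0"
    and "free_choice \<Sigma> \<Theta> X\<^sub>0 \<eta>\<^sub>0 F"
    and "C = Ob \<Sigma> \<Theta> X\<^sub>0 \<eta>\<^sub>0 F"
    and "\<forall>x\<in>X\<^sub>0. {x} \<in> C"
    and "op_generators \<Sigma> \<eta>\<^sub>0 C xs"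
    and "\<forall>\<Phi> \<Psi>. cat_automorphism \<Sigma> F C \<Phi> \<Psi> \<longrightarrow>
           (\<forall>i\<in>sorts \<Sigma>. \<forall>x\<in>X\<^sub>0. \<eta>\<^sub>0 x = i \<longrightarrow> isomorphic \<Sigma> (F (\<Phi> {x})) (F {x}))"
    and "H\<^sub>1 \<in> \<Theta>" and "H\<^sub>2 \<in> \<Theta>"
  shows "auto_equiv \<Sigma> F C H\<^sub>1 H\<^sub>2 \<longleftrightarrow>
         (\<exists>W. Op1 \<Sigma> F xs W \<and> Op2 \<Sigma> F C xs W \<and>
              geom_equiv \<Sigma> F C H\<^sub>1 (verbal_alg \<Sigma> F xs W H\<^sub>2))"
proof -
  have ob: "free_on \<Sigma> (variety \<Sigma> E) (F X) X" "\<And>x. x \<in> X \<Longrightarrow> srt (F X) x = \<eta>\<^sub>0 x" if "X \<in> C" for X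
    using that assms(3,6) by (auto simp: Ob_def free_over_def)
  interpret free_category \<Sigma> E F C xs
  proof
    show "distinct (xs \<omega>) \<and> set (xs \<omega>) \<in> C \<and> map (srt (F (set (xs \<omega>)))) (xs \<omega>) = arity \<Sigma> \<omega>"
      if "\<omega> \<in> ops \<Sigma>" for \<omega>
      using assms(8) ob(2) that by (auto simp: op_generators_def simp flip: map_eq_conv cong: map_cong)
  qed (rule ob)
  have H: "H\<^sub>1 \<in> variety \<Sigma> E" "H\<^sub>2 \<in> variety \<Sigma> E"
    using assms(3,10,11) by auto
  show ?thesis
  proof
    assume "auto_equiv \<Sigma> F C H\<^sub>1 H\<^sub>2"
    then obtain \<Phi> \<Psi> \<alpha> where aut: "cat_automorphism \<Sigma> F C \<Phi> \<Psi>"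
      and \<alpha>: "\<And>X. X \<in> C \<Longrightarrow> bij_betw (\<alpha> X) (Cl \<Sigma> H\<^sub>1 (F X)) (Cl \<Sigma> H\<^sub>2 (F (\<Phi> X)))"
      and iff: "\<And>X Y \<mu>\<^sub>1 \<mu>\<^sub>2 T. X \<in> C \<Longrightarrow> Y \<in> C \<Longrightarrow> \<mu>\<^sub>1 \<in> hom \<Sigma> (F X) (F Y) \<Longrightarrow>
        \<mu>\<^sub>2 \<in> hom \<Sigma> (F X) (F Y) \<Longrightarrow> T \<in> Cl \<Sigma> H\<^sub>1 (F Y) \<Longrightarrow>
          compose (elems (F X)) (nat_epi (F Y) T) \<mu>\<^sub>1 = compose (elems (F X)) (nat_epi (F Y) T) \<mu>\<^sub>2 \<longleftrightarrow>
          compose (elems (F (\<Phi> X))) (nat_epi (F (\<Phi> Y)) (\<alpha> Y T)) (\<Psi> X Y \<mu>\<^sub>1) =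
          compose (elems (F (\<Phi> X))) (nat_epi (F (\<Phi> Y)) (\<alpha> Y T)) (\<Psi> X Y \<mu>\<^sub>2)"
      unfolding auto_equiv_def by blast
    have "\<exists>x. x \<in> X\<^sub>0 \<and> \<eta>\<^sub>0 x = i" if "i \<in> sorts \<Sigma>" for i
    proof -
      have "{x \<in> X\<^sub>0. \<eta>\<^sub>0 x = i} \<noteq> {}"
        using assms(4) that unfolding sorted_alphabet_def by (metis finite.emptyI)
      then show ?thesis by blast
    qed
    then obtain p where p: "\<And>i. i \<in> sorts \<Sigma> \<Longrightarrow> p i \<in> X\<^sub>0" "\<And>i. i \<in> sorts \<Sigma> \<Longrightarrow> \<eta>\<^sub>0 (p i) = i"
      by metis
    have P: "{p i} \<in> C" if "i \<in> sorts \<Sigma>" for i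
      using p(1)[OF that] assms(7) by blast
    have srt_p: "srt (F {p i}) (p i) = i" if "i \<in> sorts \<Sigma>" for i
      using ob(2)[OF P[OF that]] p(2)[OF that] by simp
    \<comment> \<open>Here the assumption on automorphisms and one-generator algebras enters:
      \<open>g i\<close> is the image of \<open>p i\<close> under an isomorphism from
      \<open>F {p i}\<close> to \<open>F (\<Phi> {p i})\<close>.\<close>
    have "\<exists>g. free_on \<Sigma> (variety \<Sigma> E) (F (\<Phi> {p i})) {g} \<and> srt (F (\<Phi> {p i})) g = i"
      if i: "i \<in> sorts \<Sigma>" for i
    proof -
      have \<Phi>: "\<Phi> {p i} \<in> C"
        using aut P[OF i] by (auto simp: cat_automorphism_def endofunctor_def)
      have "isomorphic \<Sigma> (F (\<Phi> {p i})) (F {p i})"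
        using assms(9) aut p i by blast
      then obtain \<kappa> where "\<kappa> \<in> iso \<Sigma> (F (\<Phi> {p i})) (F {p i})"
        by (auto simp: isomorphic_def)
      then obtain \<psi> where \<psi>: "\<psi> \<in> iso \<Sigma> (F {p i}) (F (\<Phi> {p i}))"
        using iso_inverse[OF alg[OF P[OF i]] alg[OF \<Phi>]] by blast
      then have "srt (F (\<Phi> {p i})) (\<psi> (p i)) = i"
        using hom_srt[of \<psi> \<Sigma> "F {p i}" "F (\<Phi> {p i})" "p i"] gens_elems[OF P[OF i]] srt_p[OF i]
        by (simp add: iso_def)
      with free_on_iso[OF free[OF P[OF i]] in_variety[OF \<Phi>] \<psi>] show ?thesis by auto
    qed
    then obtain g where g: "\<And>i. i \<in> sorts \<Sigma> \<Longrightarrow> free_on \<Sigma> (variety \<Sigma> E) (F (\<Phi> {p i})) {g i}"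
      "\<And>i. i \<in> sorts \<Sigma> \<Longrightarrow> srt (F (\<Phi> {p i})) (g i) = i"
      by metis
    interpret representable_automorphism \<Sigma> E F C xs \<Phi> \<Psi> p g
      by unfold_locales (fact aut P srt_p g)+
    obtain W t where W: "Op1 \<Sigma> F xs W"
      and t: "\<And>X. X \<in> C \<Longrightarrow> t X \<in> iso \<Sigma> (F X) (verbal_alg \<Sigma> F xs W (F X))"
        "\<And>X x. X \<in> C \<Longrightarrow> x \<in> X \<Longrightarrow> t X x = x"
      and Cl_t: "\<And>H X T. X \<in> C \<Longrightarrow> T \<subseteq> sorted_pairs (F X) \<Longrightarrow>
        map_prod (t X) (t X) ` T \<in> Cl \<Sigma> H (F X) \<longleftrightarrow>
        map_prod (transport X) (transport X) ` T \<in> Cl \<Sigma> (H :: ('s, 'o, 'a) alg) (F (\<Phi> X))"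
      by (rule verbal_words) blast
    have "Op2 \<Sigma> F C xs W"
      using t unfolding Op2_def by metis
    moreover have "T \<in> Cl \<Sigma> H\<^sub>1 (F X) \<longleftrightarrow> T \<in> Cl \<Sigma> (verbal_alg \<Sigma> F xs W H\<^sub>2) (F X)" if X: "X \<in> C" for X T
    proof (cases "T \<subseteq> sorted_pairs (F X)")
      case True
      have "T \<in> Cl \<Sigma> H\<^sub>1 (F X) \<longleftrightarrow> map_prod (transport X) (transport X) ` T \<in> Cl \<Sigma> H\<^sub>2 (F (\<Phi> X))"
        by (rule Cl_transport[where \<alpha> = \<alpha>]) (fact \<alpha> iff X True)+
      \<comment> \<open>The two criteria meet over \<open>H\<^sub>2\<close>: the image of
        \<open>T\<close> under \<open>transport X\<close> is closed exactly if its image under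
        \<open>t X\<close> is, which is closedness of \<open>T\<close> over the verbal
        algebra.\<close>
      then show ?thesis
        using Cl_t[OF X True] Cl_verbal_alg[OF W X H(2) t(1)[OF X] t(2)[OF X] True] by simp
    qed (simp add: Cl_def)
    ultimately show "\<exists>W. Op1 \<Sigma> F xs W \<and> Op2 \<Sigma> F C xs W \<and> geom_equiv \<Sigma> F C H\<^sub>1 (verbal_alg \<Sigma> F xs W H\<^sub>2)"
      using W by (auto simp: geom_equiv_iff_Cl)
  qed (use auto_equiv_of_words[OF H(2)] in blast)
qed

end
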